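(* Let $\mathscr{A}$ and $\mathscr{B}$ be abelian categories such that $\mathscr{A}$ has enough injectives and enough projectives, and let $F : \mathscr{A} \to \mathscr{B}$ be any additive covariant functor. Let $c_F : S^1S_1F \to F$ be the $F$-component of the counit of the adjunction $(S^1,S_1)$, let $q : F \to \operatorname{coker}(c_F)$ be its cokernel, and let $0 \to \overline{F} \overset{\alpha_F}{\to} F \overset{\rho_F}{\to} R^0F$ be the exact sequence defining the injective stabilization $\overline{F}$. Then there are natural transformations $\theta : S^1S_1F \to \overline{F}$ and $\gamma_F : \operatorname{coker}(c_F) \to R^0F$ such that $\alpha_F\theta = c_F$ and $\gamma_F q = \rho_F$, together with exact sequences of functors $$S^1S_1F \overset{\theta}{\longrightarrow} \overline{F} \longrightarrow \overline{\operatorname{coker}(c_F)} \longrightarrow 0$$ and $$0 \longrightarrow \overline{\operatorname{coker}(c_F)} \longrightarrow \operatorname{coker}(c_F) \overset{\gamma_F}{\longrightarrow} R^0F,$$ where $\overline{\operatorname{coker}(c_F)}$ is the injective stabilization of the functor $\operatorname{coker}(c_F)$.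
   Context: All functors are additive and covariant $\mathscr{A} \to \mathscr{B}$; kernels, cokernels and exactness of functors are computed componentwise. Injective stabilization: for an additive functor $F$ and an object $B$ choose an injective copresentation $0 \to B \overset{\iota}{\to} I^0 \overset{\partial}{\to} I^1$ (exact, with $I^0, I^1$ injective). Then $R^0F(B) = \ker F(\partial)$, the map $F(\iota)$ induces a natural transformation $\rho_F : F \to R^0F$, and $\overline{F} := \ker \rho_F$, with inclusion $\alpha_F : \overline{F} \to F$. Satellites: for an object $A$ choose an exact sequence $0 \to \Omega A \overset{\iota}{\to} P \to A \to 0$ with $P$ projective; the left satellite is $S_1F(A) := \ker F(\iota)$. Choose an exact sequence $0 \to A \to I \overset{\pi}{\to} \Sigma A \to 0$ with $I$ injective; the right satellite is $S^1F(A) := \operatorname{coker} F(\pi)$. Values on morphisms are defined by lifting (resp. extending) morphisms along these sequences. It is known (Fisher-Palmquist and Newell) that $S^1$ is left adjoint to $S_1$ as endofunctors of the category of additive functors $\mathscr{A} \to \mathscr{B}$; $c : S^1S_1 \to 1$ denotes the counit of this adjunction. *)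

theory Defs
  imports "HOL-Algebra.Group"
begin

section \<open>Categories\<close>

record ('o, 'm) category =
  Obj :: "'o set"
  Arr :: "'m set"
  Src :: "'m \<Rightarrow> 'o"
  Tgt :: "'m \<Rightarrow> 'o"
  Ident :: "'o \<Rightarrow> 'm"
  Comp :: "'m \<Rightarrow> 'm \<Rightarrow> 'm"  (infixr \<open>\<cdot>\<index>\<close> 70)

definition Hom :: "('o, 'm, 'z) category_scheme \<Rightarrow> 'o \<Rightarrow> 'o \<Rightarrow> 'm set" where
  "Hom C X Y = {f \<in> Arr C. Src C f = X \<and> Tgt C f = Y}"

locale category =
  fixes C :: "('o, 'm, 'z) category_scheme" (structure)
  assumes Src_in: "f \<in> Arr C \<Longrightarrow> Src C f \<in> Obj C"
    and Tgt_in: "f \<in> Arr C \<Longrightarrow> Tgt C f \<in> Obj C"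
    and Ident_in: "X \<in> Obj C \<Longrightarrow> Ident C X \<in> Hom C X X"
    and Comp_in: "\<lbrakk>f \<in> Hom C X Y; g \<in> Hom C Y Z\<rbrakk> \<Longrightarrow> g \<cdot> f \<in> Hom C X Z"
    and Comp_Ident: "f \<in> Hom C X Y \<Longrightarrow> f \<cdot> Ident C X = f"
    and Ident_Comp: "f \<in> Hom C X Y \<Longrightarrow> Ident C Y \<cdot> f = f"
    and Comp_assoc: "\<lbrakk>f \<in> Hom C W X; g \<in> Hom C X Y; h \<in> Hom C Y Z\<rbrakk>
          \<Longrightarrow> (h \<cdot> g) \<cdot> f = h \<cdot> (g \<cdot> f)"

definition mono_arr :: "('o, 'm, 'z) category_scheme \<Rightarrow> 'm \<Rightarrow> bool" where
  "mono_arr C f \<longleftrightarrow> f \<in> Arr C \<and>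
    (\<forall>W. \<forall>g \<in> Hom C W (Src C f). \<forall>h \<in> Hom C W (Src C f).
      f \<cdot>\<^bsub>C\<^esub> g = f \<cdot>\<^bsub>C\<^esub> h \<longrightarrow> g = h)"

definition epi_arr :: "('o, 'm, 'z) category_scheme \<Rightarrow> 'm \<Rightarrow> bool" where
  "epi_arr C f \<longleftrightarrow> f \<in> Arr C \<and>
    (\<forall>Z. \<forall>g \<in> Hom C (Tgt C f) Z. \<forall>h \<in> Hom C (Tgt C f) Z.
      g \<cdot>\<^bsub>C\<^esub> f = h \<cdot>\<^bsub>C\<^esub> f \<longrightarrow> g = h)"

definition injective_obj :: "('o, 'm, 'z) category_scheme \<Rightarrow> 'o \<Rightarrow> bool" where
  "injective_obj C I \<longleftrightarrow> I \<in> Obj C \<and>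
    (\<forall>m. mono_arr C m \<longrightarrow>
      (\<forall>f \<in> Hom C (Src C m) I. \<exists>g \<in> Hom C (Tgt C m) I. g \<cdot>\<^bsub>C\<^esub> m = f))"

definition projective_obj :: "('o, 'm, 'z) category_scheme \<Rightarrow> 'o \<Rightarrow> bool" where
  "projective_obj C P \<longleftrightarrow> P \<in> Obj C \<and>
    (\<forall>e. epi_arr C e \<longrightarrow>
      (\<forall>f \<in> Hom C P (Tgt C e). \<exists>g \<in> Hom C P (Src C e). e \<cdot>\<^bsub>C\<^esub> g = f))"

definition enough_injectives :: "('o, 'm, 'z) category_scheme \<Rightarrow> bool" where
  "enough_injectives C \<longleftrightarrow>
    (\<forall>X \<in> Obj C. \<exists>I. injective_obj C I \<and> (\<exists>m \<in> Hom C X I. mono_arr C m))"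

definition enough_projectives :: "('o, 'm, 'z) category_scheme \<Rightarrow> bool" where
  "enough_projectives C \<longleftrightarrow>
    (\<forall>X \<in> Obj C. \<exists>P. projective_obj C P \<and> (\<exists>e \<in> Hom C P X. epi_arr C e))"

definition zero_object :: "('o, 'm, 'z) category_scheme \<Rightarrow> 'o \<Rightarrow> bool" where
  "zero_object C Z \<longleftrightarrow> Z \<in> Obj C \<and>
    (\<forall>X \<in> Obj C. (\<exists>!f. f \<in> Hom C X Z) \<and> (\<exists>!f. f \<in> Hom C Z X))"


section \<open>Abelian categories\<close>

record ('o, 'm) preadditive = "('o, 'm) category" +
  Add :: "'m \<Rightarrow> 'm \<Rightarrow> 'm"  (infixl \<open>\<uplus>\<index>\<close> 65)
  Zero :: "'o \<Rightarrow> 'o \<Rightarrow> 'm"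

definition hom_group :: "('o, 'm, 'z) preadditive_scheme \<Rightarrow> 'o \<Rightarrow> 'o \<Rightarrow> 'm monoid" where
  "hom_group C X Y = \<lparr>carrier = Hom C X Y, mult = Add C, one = Zero C X Y\<rparr>"

locale preadditive_category = category C for C :: "('o, 'm, 'z) preadditive_scheme" (structure) +
  assumes comm_group_hom: "\<lbrakk>X \<in> Obj C; Y \<in> Obj C\<rbrakk> \<Longrightarrow> comm_group (hom_group C X Y)"
    and Comp_Add: "\<lbrakk>f \<in> Hom C X Y; f' \<in> Hom C X Y; g \<in> Hom C Y Z\<rbrakk>
          \<Longrightarrow> g \<cdot> (f \<uplus> f') = (g \<cdot> f) \<uplus> (g \<cdot> f')"
    and Add_Comp: "\<lbrakk>f \<in> Hom C X Y; g \<in> Hom C Y Z; g' \<in> Hom C Y Z\<rbrakk>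
          \<Longrightarrow> (g \<uplus> g') \<cdot> f = (g \<cdot> f) \<uplus> (g' \<cdot> f)"

definition is_kernel :: "('o, 'm, 'z) preadditive_scheme \<Rightarrow> 'm \<Rightarrow> 'm \<Rightarrow> bool" where
  "is_kernel C f k \<longleftrightarrow> f \<in> Arr C \<and> k \<in> Arr C \<and> Tgt C k = Src C f \<and>
    f \<cdot>\<^bsub>C\<^esub> k = Zero C (Src C k) (Tgt C f) \<and>
    (\<forall>W. \<forall>h \<in> Hom C W (Src C f). f \<cdot>\<^bsub>C\<^esub> h = Zero C W (Tgt C f) \<longrightarrow>
      (\<exists>!u. u \<in> Hom C W (Src C k) \<and> k \<cdot>\<^bsub>C\<^esub> u = h))"

definition is_cokernel :: "('o, 'm, 'z) preadditive_scheme \<Rightarrow> 'm \<Rightarrow> 'm \<Rightarrow> bool" where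
  "is_cokernel C f q \<longleftrightarrow> f \<in> Arr C \<and> q \<in> Arr C \<and> Src C q = Tgt C f \<and>
    q \<cdot>\<^bsub>C\<^esub> f = Zero C (Src C f) (Tgt C q) \<and>
    (\<forall>Z. \<forall>h \<in> Hom C (Tgt C f) Z. h \<cdot>\<^bsub>C\<^esub> f = Zero C (Src C f) Z \<longrightarrow>
      (\<exists>!u. u \<in> Hom C (Tgt C q) Z \<and> u \<cdot>\<^bsub>C\<^esub> q = h))"

locale abelian_category =
  preadditive_category C for C :: "('o, 'm, 'z) preadditive_scheme" (structure) +
  assumes has_zero: "\<exists>Z. zero_object C Z"
    and has_biproducts: "\<lbrakk>X \<in> Obj C; Y \<in> Obj C\<rbrakk> \<Longrightarrow>
          \<exists>P \<in> Obj C. \<exists>i \<in> Hom C X P. \<exists>j \<in> Hom C Y P. \<exists>p \<in> Hom C P X. \<exists>q \<in> Hom C P Y.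
            p \<cdot> i = Ident C X \<and> q \<cdot> j = Ident C Y \<and>
            p \<cdot> j = Zero C Y X \<and> q \<cdot> i = Zero C X Y \<and>
            (i \<cdot> p) \<uplus> (j \<cdot> q) = Ident C P"
    and has_kernels: "f \<in> Arr C \<Longrightarrow> \<exists>k. is_kernel C f k"
    and has_cokernels: "f \<in> Arr C \<Longrightarrow> \<exists>q. is_cokernel C f q"
    and mono_is_kernel: "mono_arr C m \<Longrightarrow> \<exists>f. is_kernel C f m"
    and epi_is_cokernel: "epi_arr C e \<Longrightarrow> \<exists>f. is_cokernel C f e"

definition zero_obj :: "('o, 'm, 'z) category_scheme \<Rightarrow> 'o" where
  "zero_obj C = (SOME Z. zero_object C Z)"

definition ker :: "('o, 'm, 'z) preadditive_scheme \<Rightarrow> 'm \<Rightarrow> 'm" where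
  "ker C f = (SOME k. is_kernel C f k)"

definition coker :: "('o, 'm, 'z) preadditive_scheme \<Rightarrow> 'm \<Rightarrow> 'm" where
  "coker C f = (SOME q. is_cokernel C f q)"

text \<open>The arrow \<open>Ker f \<rightarrow> Ker f'\<close> (resp. \<open>Coker f \<rightarrow> Coker f'\<close>) induced by the left (resp. right)
  vertical arrow of a commutative square from \<open>f\<close> to \<open>f'\<close>.\<close>

definition ker_map :: "('o, 'm, 'z) preadditive_scheme \<Rightarrow> 'm \<Rightarrow> 'm \<Rightarrow> 'm \<Rightarrow> 'm" where
  "ker_map C f f' a = (THE u. u \<in> Hom C (Src C (ker C f)) (Src C (ker C f')) \<and>
     ker C f' \<cdot>\<^bsub>C\<^esub> u = a \<cdot>\<^bsub>C\<^esub> ker C f)"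

definition coker_map :: "('o, 'm, 'z) preadditive_scheme \<Rightarrow> 'm \<Rightarrow> 'm \<Rightarrow> 'm \<Rightarrow> 'm" where
  "coker_map C f f' b = (THE u. u \<in> Hom C (Tgt C (coker C f)) (Tgt C (coker C f')) \<and>
     u \<cdot>\<^bsub>C\<^esub> coker C f = coker C f' \<cdot>\<^bsub>C\<^esub> b)"

text \<open>Exactness of \<open>X \<rightarrow>\<^sup>f Y \<rightarrow>\<^sup>g Z\<close> at \<open>Y\<close>: the image of \<open>f\<close>, i.e. the kernel of its cokernel,
  is the kernel of \<open>g\<close>.\<close>

definition exact :: "('o, 'm, 'z) preadditive_scheme \<Rightarrow> 'm \<Rightarrow> 'm \<Rightarrow> bool" where
  "exact C f g \<longleftrightarrow> (\<exists>q k. is_cokernel C f q \<and> is_kernel C q k \<and> is_kernel C g k)"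

definition short_exact :: "('o, 'm, 'z) preadditive_scheme \<Rightarrow> 'm \<Rightarrow> 'm \<Rightarrow> bool" where
  "short_exact C f g \<longleftrightarrow>
    exact C (Zero C (zero_obj C) (Src C f)) f \<and> exact C f g \<and>
    exact C g (Zero C (Tgt C g) (zero_obj C))"


section \<open>Functors, natural transformations, adjunctions\<close>

record ('o1, 'm1, 'o2, 'm2) cfunctor =
  obj_map :: "'o1 \<Rightarrow> 'o2"
  arr_map :: "'m1 \<Rightarrow> 'm2"

definition is_functor :: "('o1, 'm1, 'y) category_scheme \<Rightarrow> ('o2, 'm2, 'z) category_scheme \<Rightarrow>
    ('o1, 'm1, 'o2, 'm2) cfunctor \<Rightarrow> bool" where
  "is_functor C D F \<longleftrightarrow>
    (\<forall>X \<in> Obj C. obj_map F X \<in> Obj D) \<and>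
    (\<forall>X Y. \<forall>f \<in> Hom C X Y. arr_map F f \<in> Hom D (obj_map F X) (obj_map F Y)) \<and>
    (\<forall>X \<in> Obj C. arr_map F (Ident C X) = Ident D (obj_map F X)) \<and>
    (\<forall>X Y Z. \<forall>f \<in> Hom C X Y. \<forall>g \<in> Hom C Y Z.
      arr_map F (g \<cdot>\<^bsub>C\<^esub> f) = arr_map F g \<cdot>\<^bsub>D\<^esub> arr_map F f)"

definition additive_functor :: "('o1, 'm1, 'y) preadditive_scheme \<Rightarrow>
    ('o2, 'm2, 'z) preadditive_scheme \<Rightarrow> ('o1, 'm1, 'o2, 'm2) cfunctor \<Rightarrow> bool" where
  "additive_functor C D F \<longleftrightarrow> is_functor C D F \<and>
    (\<forall>X Y. \<forall>f \<in> Hom C X Y. \<forall>g \<in> Hom C X Y.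
      arr_map F (f \<uplus>\<^bsub>C\<^esub> g) = arr_map F f \<uplus>\<^bsub>D\<^esub> arr_map F g)"

definition id_functor :: "('o, 'm, 'o, 'm) cfunctor" where
  "id_functor = \<lparr>obj_map = (\<lambda>X. X), arr_map = (\<lambda>f. f)\<rparr>"

definition comp_functor :: "('o2, 'm2, 'o3, 'm3) cfunctor \<Rightarrow> ('o1, 'm1, 'o2, 'm2) cfunctor \<Rightarrow>
    ('o1, 'm1, 'o3, 'm3) cfunctor" where
  "comp_functor G F = \<lparr>obj_map = obj_map G \<circ> obj_map F, arr_map = arr_map G \<circ> arr_map F\<rparr>"

definition natural :: "('o1, 'm1, 'y) category_scheme \<Rightarrow> ('o2, 'm2, 'z) category_scheme \<Rightarrow>
    ('o1, 'm1, 'o2, 'm2) cfunctor \<Rightarrow> ('o1, 'm1, 'o2, 'm2) cfunctor \<Rightarrow> ('o1 \<Rightarrow> 'm2) \<Rightarrow> bool" where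
  "natural C D F G t \<longleftrightarrow>
    (\<forall>X \<in> Obj C. t X \<in> Hom D (obj_map F X) (obj_map G X)) \<and>
    (\<forall>X Y. \<forall>f \<in> Hom C X Y. t Y \<cdot>\<^bsub>D\<^esub> arr_map F f = arr_map G f \<cdot>\<^bsub>D\<^esub> t X)"

definition adjunction :: "('o1, 'm1, 'y) category_scheme \<Rightarrow> ('o2, 'm2, 'z) category_scheme \<Rightarrow>
    ('o1, 'm1, 'o2, 'm2) cfunctor \<Rightarrow> ('o2, 'm2, 'o1, 'm1) cfunctor \<Rightarrow>
    ('o1 \<Rightarrow> 'm1) \<Rightarrow> ('o2 \<Rightarrow> 'm2) \<Rightarrow> bool" where
  "adjunction C D L R unit counit \<longleftrightarrow>
    is_functor C D L \<and> is_functor D C R \<and>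
    natural C C id_functor (comp_functor R L) unit \<and>
    natural D D (comp_functor L R) id_functor counit \<and>
    (\<forall>X \<in> Obj C. counit (obj_map L X) \<cdot>\<^bsub>D\<^esub> arr_map L (unit X) = Ident D (obj_map L X)) \<and>
    (\<forall>Y \<in> Obj D. arr_map R (counit Y) \<cdot>\<^bsub>C\<^esub> unit (obj_map R Y) = Ident C (obj_map R Y))"

text \<open>Natural transformations carry their source and target functors, so that they are the arrows of
  a category. The family of components is required to be \<^const>\<open>undefined\<close> off the objects of the
  source category, so that two natural transformations between the same functors are equal iff
  all their components are.\<close>

record ('o1, 'm1, 'o2, 'm2) nat_trans =
  nt_src :: "('o1, 'm1, 'o2, 'm2) cfunctor"
  nt_tgt :: "('o1, 'm1, 'o2, 'm2) cfunctor"
  cmpt :: "'o1 \<Rightarrow> 'm2"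

definition functor_category :: "('o1, 'm1, 'y) preadditive_scheme \<Rightarrow>
    ('o2, 'm2, 'z) preadditive_scheme \<Rightarrow>
    (('o1, 'm1, 'o2, 'm2) cfunctor, ('o1, 'm1, 'o2, 'm2) nat_trans) category" where
  "functor_category A B =
    \<lparr>Obj = {F. additive_functor A B F},
     Arr = {t. additive_functor A B (nt_src t) \<and> additive_functor A B (nt_tgt t) \<and>
               natural A B (nt_src t) (nt_tgt t) (cmpt t) \<and> cmpt t \<in> extensional (Obj A)},
     Src = nt_src,
     Tgt = nt_tgt,
     Ident = (\<lambda>F. \<lparr>nt_src = F, nt_tgt = F, cmpt = (\<lambda>X \<in> Obj A. Ident B (obj_map F X))\<rparr>),
     Comp = (\<lambda>t s. \<lparr>nt_src = nt_src s, nt_tgt = nt_tgt t,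
                      cmpt = (\<lambda>X \<in> Obj A. cmpt t X \<cdot>\<^bsub>B\<^esub> cmpt s X)\<rparr>)\<rparr>"


section \<open>Componentwise kernels, cokernels and exactness of functors\<close>

definition ker_functor :: "('o1, 'm1, 'y) preadditive_scheme \<Rightarrow>
    ('o2, 'm2, 'z) preadditive_scheme \<Rightarrow>
    ('o1, 'm1, 'o2, 'm2) nat_trans \<Rightarrow> ('o1, 'm1, 'o2, 'm2) cfunctor" where
  "ker_functor A B t =
    \<lparr>obj_map = (\<lambda>X. Src B (ker B (cmpt t X))),
     arr_map = (\<lambda>f. ker_map B (cmpt t (Src A f)) (cmpt t (Tgt A f)) (arr_map (nt_src t) f))\<rparr>"

definition ker_nt :: "('o1, 'm1, 'y) preadditive_scheme \<Rightarrow>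
    ('o2, 'm2, 'z) preadditive_scheme \<Rightarrow>
    ('o1, 'm1, 'o2, 'm2) nat_trans \<Rightarrow> ('o1, 'm1, 'o2, 'm2) nat_trans" where
  "ker_nt A B t =
    \<lparr>nt_src = ker_functor A B t, nt_tgt = nt_src t, cmpt = (\<lambda>X \<in> Obj A. ker B (cmpt t X))\<rparr>"

definition coker_functor :: "('o1, 'm1, 'y) preadditive_scheme \<Rightarrow>
    ('o2, 'm2, 'z) preadditive_scheme \<Rightarrow>
    ('o1, 'm1, 'o2, 'm2) nat_trans \<Rightarrow> ('o1, 'm1, 'o2, 'm2) cfunctor" where
  "coker_functor A B t =
    \<lparr>obj_map = (\<lambda>X. Tgt B (coker B (cmpt t X))),
     arr_map = (\<lambda>f. coker_map B (cmpt t (Src A f)) (cmpt t (Tgt A f)) (arr_map (nt_tgt t) f))\<rparr>"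

definition coker_nt :: "('o1, 'm1, 'y) preadditive_scheme \<Rightarrow>
    ('o2, 'm2, 'z) preadditive_scheme \<Rightarrow>
    ('o1, 'm1, 'o2, 'm2) nat_trans \<Rightarrow> ('o1, 'm1, 'o2, 'm2) nat_trans" where
  "coker_nt A B t =
    \<lparr>nt_src = nt_tgt t, nt_tgt = coker_functor A B t, cmpt = (\<lambda>X \<in> Obj A. coker B (cmpt t X))\<rparr>"

definition zero_functor :: "('o2, 'm2, 'z) preadditive_scheme \<Rightarrow>
    ('o1, 'm1, 'o2, 'm2) cfunctor" where
  "zero_functor B =
    \<lparr>obj_map = (\<lambda>_. zero_obj B), arr_map = (\<lambda>_. Zero B (zero_obj B) (zero_obj B))\<rparr>"

definition zero_nt :: "('o1, 'm1, 'y) preadditive_scheme \<Rightarrow>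
    ('o2, 'm2, 'z) preadditive_scheme \<Rightarrow> ('o1, 'm1, 'o2, 'm2) cfunctor \<Rightarrow>
    ('o1, 'm1, 'o2, 'm2) cfunctor \<Rightarrow> ('o1, 'm1, 'o2, 'm2) nat_trans" where
  "zero_nt A B F G =
    \<lparr>nt_src = F, nt_tgt = G, cmpt = (\<lambda>X \<in> Obj A. Zero B (obj_map F X) (obj_map G X))\<rparr>"

definition exact_nt :: "('o1, 'm1, 'y) preadditive_scheme \<Rightarrow>
    ('o2, 'm2, 'z) preadditive_scheme \<Rightarrow> ('o1, 'm1, 'o2, 'm2) nat_trans \<Rightarrow>
    ('o1, 'm1, 'o2, 'm2) nat_trans \<Rightarrow> bool" where
  "exact_nt A B s t \<longleftrightarrow> nt_tgt s = nt_src t \<and> (\<forall>X \<in> Obj A. exact B (cmpt s X) (cmpt t X))"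


section \<open>The injective stabilization\<close>

text \<open>A choice \<open>0 \<rightarrow> X \<rightarrow>\<^sup>i I\<^sup>0 \<rightarrow>\<^sup>d I\<^sup>1\<close> of injective copresentations of all objects is
  given by the two families of arrows \<open>i\<close>, \<open>d\<close>; the objects \<open>I\<^sup>0\<close>, \<open>I\<^sup>1\<close> are their targets.\<close>

definition injective_copresentations ::
    "('o, 'm, 'z) preadditive_scheme \<Rightarrow> ('o \<Rightarrow> 'm) \<Rightarrow> ('o \<Rightarrow> 'm) \<Rightarrow> bool" where
  "injective_copresentations A i d \<longleftrightarrow> (\<forall>X \<in> Obj A.
    i X \<in> Arr A \<and> Src A (i X) = X \<and> d X \<in> Arr A \<and>
    injective_obj A (Tgt A (i X)) \<and> injective_obj A (Tgt A (d X)) \<and>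
    exact A (Zero A (zero_obj A) X) (i X) \<and> exact A (i X) (d X))"

definition copresentation_lift :: "('o, 'm, 'z) preadditive_scheme \<Rightarrow>
    ('o \<Rightarrow> 'm) \<Rightarrow> ('o \<Rightarrow> 'm) \<Rightarrow> 'm \<Rightarrow> 'm" where
  "copresentation_lift A i d f = (let X = Src A f; Y = Tgt A f in
    SOME a. a \<in> Hom A (Tgt A (i X)) (Tgt A (i Y)) \<and> a \<cdot>\<^bsub>A\<^esub> i X = i Y \<cdot>\<^bsub>A\<^esub> f \<and>
      (\<exists>b \<in> Hom A (Tgt A (d X)) (Tgt A (d Y)). b \<cdot>\<^bsub>A\<^esub> d X = d Y \<cdot>\<^bsub>A\<^esub> a))"

definition R0 :: "('o1, 'm1, 'y) preadditive_scheme \<Rightarrow> ('o2, 'm2, 'z) preadditive_scheme \<Rightarrow>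
    ('o1 \<Rightarrow> 'm1) \<Rightarrow> ('o1 \<Rightarrow> 'm1) \<Rightarrow>
    ('o1, 'm1, 'o2, 'm2) cfunctor \<Rightarrow> ('o1, 'm1, 'o2, 'm2) cfunctor" where
  "R0 A B i d F =
    \<lparr>obj_map = (\<lambda>X. Src B (ker B (arr_map F (d X)))),
     arr_map = (\<lambda>f. ker_map B (arr_map F (d (Src A f))) (arr_map F (d (Tgt A f)))
                       (arr_map F (copresentation_lift A i d f)))\<rparr>"

definition rho :: "('o1, 'm1, 'y) preadditive_scheme \<Rightarrow> ('o2, 'm2, 'z) preadditive_scheme \<Rightarrow>
    ('o1 \<Rightarrow> 'm1) \<Rightarrow> ('o1 \<Rightarrow> 'm1) \<Rightarrow>
    ('o1, 'm1, 'o2, 'm2) cfunctor \<Rightarrow> ('o1, 'm1, 'o2, 'm2) nat_trans" where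
  "rho A B i d F =
    \<lparr>nt_src = F, nt_tgt = R0 A B i d F,
     cmpt = (\<lambda>X \<in> Obj A. THE u. u \<in> Hom B (obj_map F X) (Src B (ker B (arr_map F (d X)))) \<and>
               ker B (arr_map F (d X)) \<cdot>\<^bsub>B\<^esub> u = arr_map F (i X))\<rparr>"

definition injective_stabilization ::
    "('o1, 'm1, 'y) preadditive_scheme \<Rightarrow> ('o2, 'm2, 'z) preadditive_scheme \<Rightarrow>
    ('o1 \<Rightarrow> 'm1) \<Rightarrow> ('o1 \<Rightarrow> 'm1) \<Rightarrow>
    ('o1, 'm1, 'o2, 'm2) cfunctor \<Rightarrow> ('o1, 'm1, 'o2, 'm2) cfunctor" where
  "injective_stabilization A B i d F = ker_functor A B (rho A B i d F)"

definition alpha :: "('o1, 'm1, 'y) preadditive_scheme \<Rightarrow> ('o2, 'm2, 'z) preadditive_scheme \<Rightarrow>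
    ('o1 \<Rightarrow> 'm1) \<Rightarrow> ('o1 \<Rightarrow> 'm1) \<Rightarrow>
    ('o1, 'm1, 'o2, 'm2) cfunctor \<Rightarrow> ('o1, 'm1, 'o2, 'm2) nat_trans" where
  "alpha A B i d F = ker_nt A B (rho A B i d F)"


section \<open>Satellites\<close>

text \<open>A choice \<open>0 \<rightarrow> \<Omega> X \<rightarrow>\<^sup>w P \<rightarrow>\<^sup>p X \<rightarrow> 0\<close> of syzygy sequences; \<open>\<Omega> X\<close> and \<open>P\<close> are the source and
  target of \<open>w X\<close>.\<close>

definition syzygy_sequences ::
    "('o, 'm, 'z) preadditive_scheme \<Rightarrow> ('o \<Rightarrow> 'm) \<Rightarrow> ('o \<Rightarrow> 'm) \<Rightarrow> bool" where
  "syzygy_sequences A w p \<longleftrightarrow> (\<forall>X \<in> Obj A.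
    w X \<in> Arr A \<and> p X \<in> Arr A \<and> Tgt A (p X) = X \<and>
    projective_obj A (Tgt A (w X)) \<and> short_exact A (w X) (p X))"

definition syzygy_lift :: "('o, 'm, 'z) preadditive_scheme \<Rightarrow>
    ('o \<Rightarrow> 'm) \<Rightarrow> ('o \<Rightarrow> 'm) \<Rightarrow> 'm \<Rightarrow> 'm" where
  "syzygy_lift A w p f = (let X = Src A f; Y = Tgt A f in
    SOME a. a \<in> Hom A (Src A (w X)) (Src A (w Y)) \<and>
      (\<exists>b \<in> Hom A (Tgt A (w X)) (Tgt A (w Y)).
        p Y \<cdot>\<^bsub>A\<^esub> b = f \<cdot>\<^bsub>A\<^esub> p X \<and> w Y \<cdot>\<^bsub>A\<^esub> a = b \<cdot>\<^bsub>A\<^esub> w X))"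

definition left_satellite_obj ::
    "('o1, 'm1, 'y) preadditive_scheme \<Rightarrow> ('o2, 'm2, 'z) preadditive_scheme \<Rightarrow>
    ('o1 \<Rightarrow> 'm1) \<Rightarrow> ('o1 \<Rightarrow> 'm1) \<Rightarrow>
    ('o1, 'm1, 'o2, 'm2) cfunctor \<Rightarrow> ('o1, 'm1, 'o2, 'm2) cfunctor" where
  "left_satellite_obj A B w p F =
    \<lparr>obj_map = (\<lambda>X. Src B (ker B (arr_map F (w X)))),
     arr_map = (\<lambda>f. ker_map B (arr_map F (w (Src A f))) (arr_map F (w (Tgt A f)))
                       (arr_map F (syzygy_lift A w p f)))\<rparr>"

text \<open>\<open>S\<^sub>1\<close> as an endofunctor of the category of additive functors.\<close>

definition left_satellite ::
    "('o1, 'm1, 'y) preadditive_scheme \<Rightarrow> ('o2, 'm2, 'z) preadditive_scheme \<Rightarrow>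
    ('o1 \<Rightarrow> 'm1) \<Rightarrow> ('o1 \<Rightarrow> 'm1) \<Rightarrow>
    (('o1, 'm1, 'o2, 'm2) cfunctor, ('o1, 'm1, 'o2, 'm2) nat_trans,
     ('o1, 'm1, 'o2, 'm2) cfunctor, ('o1, 'm1, 'o2, 'm2) nat_trans) cfunctor" where
  "left_satellite A B w p =
    \<lparr>obj_map = left_satellite_obj A B w p,
     arr_map = (\<lambda>t. \<lparr>nt_src = left_satellite_obj A B w p (nt_src t),
                      nt_tgt = left_satellite_obj A B w p (nt_tgt t),
                      cmpt = (\<lambda>X \<in> Obj A. ker_map B (arr_map (nt_src t) (w X))
                                (arr_map (nt_tgt t) (w X)) (cmpt t (Src A (w X))))\<rparr>)\<rparr>"

text \<open>A choice \<open>0 \<rightarrow> X \<rightarrow>\<^sup>v I \<rightarrow>\<^sup>s \<Sigma> X \<rightarrow> 0\<close> of cosyzygy sequences; \<open>I\<close> and \<open>\<Sigma> X\<close> are the source and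
  target of \<open>s X\<close>.\<close>

definition cosyzygy_sequences ::
    "('o, 'm, 'z) preadditive_scheme \<Rightarrow> ('o \<Rightarrow> 'm) \<Rightarrow> ('o \<Rightarrow> 'm) \<Rightarrow> bool" where
  "cosyzygy_sequences A v s \<longleftrightarrow> (\<forall>X \<in> Obj A.
    v X \<in> Arr A \<and> s X \<in> Arr A \<and> Src A (v X) = X \<and>
    injective_obj A (Src A (s X)) \<and> short_exact A (v X) (s X))"

definition cosyzygy_lift :: "('o, 'm, 'z) preadditive_scheme \<Rightarrow>
    ('o \<Rightarrow> 'm) \<Rightarrow> ('o \<Rightarrow> 'm) \<Rightarrow> 'm \<Rightarrow> 'm" where
  "cosyzygy_lift A v s f = (let X = Src A f; Y = Tgt A f in
    SOME a. a \<in> Hom A (Tgt A (s X)) (Tgt A (s Y)) \<and>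
      (\<exists>b \<in> Hom A (Src A (s X)) (Src A (s Y)).
        b \<cdot>\<^bsub>A\<^esub> v X = v Y \<cdot>\<^bsub>A\<^esub> f \<and> a \<cdot>\<^bsub>A\<^esub> s X = s Y \<cdot>\<^bsub>A\<^esub> b))"

definition right_satellite_obj ::
    "('o1, 'm1, 'y) preadditive_scheme \<Rightarrow> ('o2, 'm2, 'z) preadditive_scheme \<Rightarrow>
    ('o1 \<Rightarrow> 'm1) \<Rightarrow> ('o1 \<Rightarrow> 'm1) \<Rightarrow>
    ('o1, 'm1, 'o2, 'm2) cfunctor \<Rightarrow> ('o1, 'm1, 'o2, 'm2) cfunctor" where
  "right_satellite_obj A B v s F =
    \<lparr>obj_map = (\<lambda>X. Tgt B (coker B (arr_map F (s X)))),
     arr_map = (\<lambda>f. coker_map B (arr_map F (s (Src A f))) (arr_map F (s (Tgt A f)))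
                       (arr_map F (cosyzygy_lift A v s f)))\<rparr>"

text \<open>\<open>S\<^sup>1\<close> as an endofunctor of the category of additive functors.\<close>

definition right_satellite ::
    "('o1, 'm1, 'y) preadditive_scheme \<Rightarrow> ('o2, 'm2, 'z) preadditive_scheme \<Rightarrow>
    ('o1 \<Rightarrow> 'm1) \<Rightarrow> ('o1 \<Rightarrow> 'm1) \<Rightarrow>
    (('o1, 'm1, 'o2, 'm2) cfunctor, ('o1, 'm1, 'o2, 'm2) nat_trans,
     ('o1, 'm1, 'o2, 'm2) cfunctor, ('o1, 'm1, 'o2, 'm2) nat_trans) cfunctor" where
  "right_satellite A B v s =
    \<lparr>obj_map = right_satellite_obj A B v s,
     arr_map = (\<lambda>t. \<lparr>nt_src = right_satellite_obj A B v s (nt_src t),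
                      nt_tgt = right_satellite_obj A B v s (nt_tgt t),
                      cmpt = (\<lambda>X \<in> Obj A. coker_map B (arr_map (nt_src t) (s X))
                                (arr_map (nt_tgt t) (s X)) (cmpt t (Tgt A (s X))))\<rparr>)\<rparr>"

end

theory Submission
  imports Defs
begin

text \<open>The counit \<open>c\<^sub>F : S\<^sup>1S\<^sub>1F \<rightarrow> F\<close> vanishes at every injective object \<open>I\<close>: the cosyzygy sequence
  of \<open>I\<close> splits, so \<open>S\<^sup>1G(I) = 0\<close> for every additive \<open>G\<close> (\<open>right_satellite_vanishes\<close>). The
  proposition holds for every natural transformation \<open>t : S \<rightarrow> F\<close> with this property
  (\<open>exact_sequences_of_vanishing_nt\<close>); write \<open>q : F \<rightarrow> Q\<close> for its cokernel.

  Let \<open>i : X \<rightarrow> I\<close> be the first map of the injective copresentation of \<open>X\<close>. Naturality of \<open>t\<close>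
  along \<open>i\<close> gives \<open>F(i) t\<^sub>X = t\<^sub>I S(i) = 0\<close>, hence \<open>\<rho>\<^sub>F t = 0\<close> (\<open>rho_kills\<close>). So \<open>t\<close> factors
  through the kernel \<open>\<alpha>\<^sub>F\<close> of \<open>\<rho>\<^sub>F\<close>, which gives \<open>\<theta>\<close>, and \<open>\<rho>\<^sub>F\<close> factors through the cokernel \<open>q\<close>,
  which gives \<open>\<gamma>\<close>.

  The kernel of \<open>\<gamma>\<close> is the injective stabilization of \<open>Q\<close> (\<open>alpha_coker_is_kernel\<close>). Indeed that
  stabilization at \<open>X\<close> is the kernel of \<open>Q(i)\<close>. As \<open>t\<^sub>I = 0\<close>, the map \<open>q\<^sub>I\<close> is an isomorphism,
  so \<open>Q(i)\<close> is \<open>\<gamma>\<^sub>X\<close> followed by the inclusion \<open>R\<^sup>0F(X) \<rightarrow> F(I)\<close> and the monomorphism \<open>q\<^sub>I\<close>. This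
  is the second exact sequence.

  The first one is a general fact about abelian categories (\<open>restricted_cokernel\<close>): a cokernel \<open>q\<close>
  of \<open>t\<close> restricts to a cokernel of \<open>\<theta>\<close> from the kernel of \<open>\<gamma> q\<close> to the kernel of \<open>\<gamma>\<close>. It rests on
  the epi-mono factorization (\<open>epi_onto_image\<close>) and on the fact that epimorphisms are stable under
  pullback along a kernel (\<open>kernel_of_composite_epi\<close>).

  The functors \<open>S\<^sup>1S\<^sub>1F\<close> and their maps come with the adjunction. For \<open>R\<^sup>0F\<close>, by contrast,
  functoriality has to be proved: it depends on chosen extensions of arrows to injective objects,
  and two choices agree on the kernels that define \<open>R\<^sup>0F\<close> (\<open>extensions_agree_on_kernel\<close>).\<close>

section \<open>Preadditive categories\<close>

lemma HomD:
  assumes "f \<in> Hom C X Y"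
  shows "f \<in> Arr C" and "Src C f = X" and "Tgt C f = Y"
  using assms by (auto simp: Hom_def)

context category
begin

lemma Hom_Src_in: "f \<in> Hom C X Y \<Longrightarrow> X \<in> Obj C"
  using Src_in by (auto simp: Hom_def)

lemma Hom_Tgt_in: "f \<in> Hom C X Y \<Longrightarrow> Y \<in> Obj C"
  using Tgt_in by (auto simp: Hom_def)

lemma mono_cancel:
  "\<lbrakk>mono_arr C k; k \<in> Hom C K X; g \<in> Hom C W K; h \<in> Hom C W K; k \<cdot> g = k \<cdot> h\<rbrakk> \<Longrightarrow> g = h"
  by (auto simp: mono_arr_def Hom_def)

lemma epi_cancel:
  "\<lbrakk>epi_arr C e; e \<in> Hom C X E; g \<in> Hom C E Z; h \<in> Hom C E Z; g \<cdot> e = h \<cdot> e\<rbrakk> \<Longrightarrow> g = h"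
  by (auto simp: epi_arr_def Hom_def)

lemma injective_extend:
  assumes "injective_obj C I" "mono_arr C m" "m \<in> Hom C X Y" "f \<in> Hom C X I"
  shows "\<exists>g \<in> Hom C Y I. g \<cdot> m = f"
proof -
  have "\<forall>f \<in> Hom C (Src C m) I. \<exists>g \<in> Hom C (Tgt C m) I. g \<cdot> m = f"
    using assms(1,2) by (simp add: injective_obj_def)
  then show ?thesis using assms(4) HomD[OF assms(3)] by simp
qed

lemma mono_Comp:
  assumes "mono_arr C j" "mono_arr C m" "j \<in> Hom C X Y" "m \<in> Hom C Y Z"
  shows "mono_arr C (m \<cdot> j)"
  unfolding mono_arr_def
proof (intro conjI allI ballI impI)
  have mj: "m \<cdot> j \<in> Hom C X Z" using assms Comp_in by blast
  show "m \<cdot> j \<in> Arr C" using mj by (simp add: Hom_def)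
  fix W g h
  assume "g \<in> Hom C W (Src C (m \<cdot> j))" "h \<in> Hom C W (Src C (m \<cdot> j))"
    and eq: "(m \<cdot> j) \<cdot> g = (m \<cdot> j) \<cdot> h"
  then have gh: "g \<in> Hom C W X" "h \<in> Hom C W X" using HomD(2)[OF mj] by simp_all
  have "m \<cdot> (j \<cdot> g) = m \<cdot> (j \<cdot> h)"
    using eq Comp_assoc[OF gh(1) assms(3,4)] Comp_assoc[OF gh(2) assms(3,4)] by simp
  then have "j \<cdot> g = j \<cdot> h"
    using mono_cancel[OF assms(2,4) Comp_in[OF gh(1) assms(3)] Comp_in[OF gh(2) assms(3)]] by simp
  then show "g = h" by (rule mono_cancel[OF assms(1,3) gh])
qed

lemma mono_if_retraction:
  assumes "m \<in> Hom C X Y" "r \<in> Hom C Y X" "r \<cdot> m = Ident C X"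
  shows "mono_arr C m"
  unfolding mono_arr_def
proof (intro conjI allI ballI impI)
  show "m \<in> Arr C" using assms by (simp add: Hom_def)
  fix W g h
  assume "g \<in> Hom C W (Src C m)" "h \<in> Hom C W (Src C m)" and eq: "m \<cdot> g = m \<cdot> h"
  then have gh: "g \<in> Hom C W X" "h \<in> Hom C W X" using HomD(2)[OF assms(1)] by simp_all
  have "(r \<cdot> m) \<cdot> g = (r \<cdot> m) \<cdot> h"
    using eq Comp_assoc[OF gh(1) assms(1,2)] Comp_assoc[OF gh(2) assms(1,2)] by simp
  then show "g = h" using assms(3) Ident_Comp gh by simp
qed

lemma epi_if_section:
  assumes "e \<in> Hom C X Y" "t \<in> Hom C Y X" "e \<cdot> t = Ident C Y"
  shows "epi_arr C e"
  unfolding epi_arr_def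
proof (intro conjI allI ballI impI)
  show "e \<in> Arr C" using assms by (simp add: Hom_def)
  fix Z g h
  assume "g \<in> Hom C (Tgt C e) Z" "h \<in> Hom C (Tgt C e) Z" and eq: "g \<cdot> e = h \<cdot> e"
  then have gh: "g \<in> Hom C Y Z" "h \<in> Hom C Y Z" using HomD(3)[OF assms(1)] by simp_all
  have "g \<cdot> (e \<cdot> t) = h \<cdot> (e \<cdot> t)"
    using eq Comp_assoc[OF assms(2,1) gh(1)] Comp_assoc[OF assms(2,1) gh(2)] by simp
  then show "g = h" using assms(3) Comp_Ident gh by simp
qed

end

context preadditive_category
begin

lemma Zero_in: "\<lbrakk>X \<in> Obj C; Y \<in> Obj C\<rbrakk> \<Longrightarrow> Zero C X Y \<in> Hom C X Y"
  using comm_group_hom[of X Y] monoid.one_closed[of "hom_group C X Y"]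
  by (simp add: comm_group_def group_def hom_group_def)

lemma Add_in:
  assumes "f \<in> Hom C X Y" "g \<in> Hom C X Y"
  shows "f \<uplus> g \<in> Hom C X Y"
proof -
  interpret comm_group "hom_group C X Y"
    using comm_group_hom Hom_Src_in Hom_Tgt_in assms by blast
  show ?thesis using m_closed assms by (simp add: hom_group_def)
qed

lemma Zero_Add:
  assumes "f \<in> Hom C X Y"
  shows "Zero C X Y \<uplus> f = f"
proof -
  interpret comm_group "hom_group C X Y"
    using comm_group_hom Hom_Src_in Hom_Tgt_in assms by blast
  show ?thesis using l_one assms by (simp add: hom_group_def)
qed

lemma Add_eq_right_iff:
  assumes "f \<in> Hom C X Y" "g \<in> Hom C X Y"
  shows "f \<uplus> g = g \<longleftrightarrow> f = Zero C X Y"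
proof -
  interpret comm_group "hom_group C X Y"
    using comm_group_hom Hom_Src_in Hom_Tgt_in assms by blast
  show ?thesis using l_cancel_one[of g f] r_cancel_one[of g f] assms by (simp add: hom_group_def)
qed

text \<open>Subtraction in the form in which it is used below: \<open>e\<close> is the difference of \<open>f\<close> and \<open>g\<close>.\<close>

lemma difference_ex:
  assumes "f \<in> Hom C X Y" "g \<in> Hom C X Y"
  shows "\<exists>e \<in> Hom C X Y. f = e \<uplus> g"
proof -
  interpret G: comm_group "hom_group C X Y"
    using comm_group_hom Hom_Src_in Hom_Tgt_in assms by blast
  have fg: "f \<in> carrier (hom_group C X Y)" "g \<in> carrier (hom_group C X Y)"
    using assms by (simp_all add: hom_group_def)
  let ?e = "f \<otimes>\<^bsub>hom_group C X Y\<^esub> inv\<^bsub>hom_group C X Y\<^esub> g"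
  have "?e \<in> carrier (hom_group C X Y)" "f = ?e \<otimes>\<^bsub>hom_group C X Y\<^esub> g"
    using fg by (simp_all add: G.m_assoc)
  then show ?thesis by (auto simp: hom_group_def)
qed

lemma Comp_Zero:
  assumes "g \<in> Hom C Y Z" "X \<in> Obj C"
  shows "g \<cdot> Zero C X Y = Zero C X Z"
proof -
  have z: "Zero C X Y \<in> Hom C X Y" using Zero_in assms Hom_Src_in by blast
  have "g \<cdot> Zero C X Y \<uplus> g \<cdot> Zero C X Y = g \<cdot> Zero C X Y"
    using Comp_Add[OF z z assms(1)] Zero_Add[OF z] by simp
  then show ?thesis using Add_eq_right_iff[of _ X Z] Comp_in[OF z assms(1)] by blast
qed

lemma Zero_Comp:
  assumes "f \<in> Hom C X Y" "Z \<in> Obj C"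
  shows "Zero C Y Z \<cdot> f = Zero C X Z"
proof -
  have z: "Zero C Y Z \<in> Hom C Y Z" using Zero_in assms Hom_Tgt_in by blast
  have "Zero C Y Z \<cdot> f \<uplus> Zero C Y Z \<cdot> f = Zero C Y Z \<cdot> f"
    using Add_Comp[OF assms(1) z z] Zero_Add[OF z] by simp
  then show ?thesis using Add_eq_right_iff[of _ X Z] Comp_in[OF assms(1) z] by blast
qed

lemma mono_if_cancel_Zero:
  assumes m: "m \<in> Hom C X Y"
    and *: "\<And>W h. \<lbrakk>h \<in> Hom C W X; m \<cdot> h = Zero C W Y\<rbrakk> \<Longrightarrow> h = Zero C W X"
  shows "mono_arr C m"
  unfolding mono_arr_def
proof (intro conjI allI ballI impI)
  show "m \<in> Arr C" using m by (simp add: Hom_def)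
  fix W g h
  assume "g \<in> Hom C W (Src C m)" "h \<in> Hom C W (Src C m)" and eq: "m \<cdot> g = m \<cdot> h"
  then have gh: "g \<in> Hom C W X" "h \<in> Hom C W X" using HomD(2)[OF m] by simp_all
  obtain e where e: "e \<in> Hom C W X" "g = e \<uplus> h" using difference_ex[OF gh] by blast
  have "m \<cdot> e \<uplus> m \<cdot> h = m \<cdot> h" using Comp_Add[OF e(1) gh(2) m] eq e(2) by simp
  then have "m \<cdot> e = Zero C W Y"
    using Add_eq_right_iff Comp_in[OF e(1) m] Comp_in[OF gh(2) m] by blast
  then have "e = Zero C W X" using * e(1) by blast
  then show "g = h" using e(2) Zero_Add[OF gh(2)] by simp
qed

lemma epi_if_cancel_Zero:
  assumes m: "m \<in> Hom C X Y"
    and *: "\<And>Z h. \<lbrakk>h \<in> Hom C Y Z; h \<cdot> m = Zero C X Z\<rbrakk> \<Longrightarrow> h = Zero C Y Z"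
  shows "epi_arr C m"
  unfolding epi_arr_def
proof (intro conjI allI ballI impI)
  show "m \<in> Arr C" using m by (simp add: Hom_def)
  fix Z g h
  assume "g \<in> Hom C (Tgt C m) Z" "h \<in> Hom C (Tgt C m) Z" and eq: "g \<cdot> m = h \<cdot> m"
  then have gh: "g \<in> Hom C Y Z" "h \<in> Hom C Y Z" using HomD(3)[OF m] by simp_all
  obtain e where e: "e \<in> Hom C Y Z" "g = e \<uplus> h" using difference_ex[OF gh] by blast
  have "e \<cdot> m \<uplus> h \<cdot> m = h \<cdot> m" using Add_Comp[OF m e(1) gh(2)] eq e(2) by simp
  then have "e \<cdot> m = Zero C X Z"
    using Add_eq_right_iff Comp_in[OF m e(1)] Comp_in[OF m gh(2)] by blast
  then have "e = Zero C Y Z" using * e(1) by blast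
  then show "g = h" using e(2) Zero_Add[OF gh(2)] by simp
qed

lemma mono_cancel_Zero:
  assumes "mono_arr C m" "m \<in> Hom C X Y" "h \<in> Hom C W X" "m \<cdot> h = Zero C W Y"
  shows "h = Zero C W X"
proof -
  have W: "W \<in> Obj C" and X: "X \<in> Obj C" using Hom_Src_in Hom_Tgt_in assms(3) by blast+
  show ?thesis
    using mono_cancel[OF assms(1-3) Zero_in[OF W X]] Comp_Zero[OF assms(2) W] assms(4) by simp
qed

lemma epi_cancel_Zero:
  assumes "epi_arr C m" "m \<in> Hom C X Y" "h \<in> Hom C Y Z" "h \<cdot> m = Zero C X Z"
  shows "h = Zero C Y Z"
proof -
  have Y: "Y \<in> Obj C" and Z: "Z \<in> Obj C" using Hom_Src_in Hom_Tgt_in assms(3) by blast+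
  show ?thesis
    using epi_cancel[OF assms(1-3) Zero_in[OF Y Z]] Zero_Comp[OF assms(2) Z] assms(4) by simp
qed

lemma Zero_Comp_left:
  assumes "f \<in> Hom C W X" "g \<in> Hom C X Y" "h \<in> Hom C Y Z" "h \<cdot> g = Zero C X Z"
  shows "h \<cdot> (g \<cdot> f) = Zero C W Z"
  using Comp_assoc[OF assms(1-3)] Zero_Comp[OF assms(1) Hom_Tgt_in[OF assms(3)]] assms(4) by simp

lemma Zero_Comp_right:
  assumes "f \<in> Hom C W X" "g \<in> Hom C X Y" "h \<in> Hom C Y Z" "g \<cdot> f = Zero C W Y"
  shows "(h \<cdot> g) \<cdot> f = Zero C W Z"
  using Comp_assoc[OF assms(1-3)] Comp_Zero[OF assms(3) Hom_Src_in[OF assms(1)]] assms(4) by simp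


section \<open>Kernels and cokernels\<close>

lemma is_kernel_iff:
  assumes f: "f \<in> Hom C X Y" and k: "k \<in> Hom C K X"
  shows "is_kernel C f k \<longleftrightarrow> f \<cdot> k = Zero C K Y \<and> mono_arr C k \<and>
    (\<forall>W. \<forall>h \<in> Hom C W X. f \<cdot> h = Zero C W Y \<longrightarrow> (\<exists>u \<in> Hom C W K. k \<cdot> u = h))"
    (is "?L \<longleftrightarrow> ?R")
proof
  assume L: ?L
  then have z: "f \<cdot> k = Zero C K Y"
    and lift: "\<And>W h. h \<in> Hom C W X \<Longrightarrow> f \<cdot> h = Zero C W Y \<Longrightarrow> \<exists>!u. u \<in> Hom C W K \<and> k \<cdot> u = h"
    using HomD[OF f] HomD[OF k] by (auto simp: is_kernel_def)
  have "mono_arr C k"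
    unfolding mono_arr_def
  proof (intro conjI allI ballI impI)
    show "k \<in> Arr C" using k by (simp add: Hom_def)
    fix W g h
    assume "g \<in> Hom C W (Src C k)" "h \<in> Hom C W (Src C k)" and eq: "k \<cdot> g = k \<cdot> h"
    then have gh: "g \<in> Hom C W K" "h \<in> Hom C W K" using HomD(2)[OF k] by simp_all
    have "f \<cdot> (k \<cdot> g) = Zero C W Y" using Zero_Comp_left[OF gh(1) k f z] .
    then have "\<exists>!u. u \<in> Hom C W K \<and> k \<cdot> u = k \<cdot> g" using lift[OF Comp_in[OF gh(1) k]] by simp
    then show "g = h" using gh eq by (elim ex1E) metis
  qed
  then show ?R using z lift by (blast dest: ex1_implies_ex)
next
  assume R: ?R
  then have "mono_arr C k" by blast
  note uniq = mono_cancel[OF this k]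
  have "\<exists>!u. u \<in> Hom C W K \<and> k \<cdot> u = h" if h: "h \<in> Hom C W X" "f \<cdot> h = Zero C W Y" for W h
  proof -
    obtain u where "u \<in> Hom C W K" "k \<cdot> u = h" using R h by blast
    then show ?thesis using uniq by metis
  qed
  then show ?L using R HomD[OF f] HomD[OF k] by (simp add: is_kernel_def)
qed

lemma is_cokernel_iff:
  assumes f: "f \<in> Hom C X Y" and q: "q \<in> Hom C Y E"
  shows "is_cokernel C f q \<longleftrightarrow> q \<cdot> f = Zero C X E \<and> epi_arr C q \<and>
    (\<forall>Z. \<forall>h \<in> Hom C Y Z. h \<cdot> f = Zero C X Z \<longrightarrow> (\<exists>u \<in> Hom C E Z. u \<cdot> q = h))"
    (is "?L \<longleftrightarrow> ?R")
proof
  assume L: ?L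
  then have z: "q \<cdot> f = Zero C X E"
    and ext: "\<And>Z h. h \<in> Hom C Y Z \<Longrightarrow> h \<cdot> f = Zero C X Z \<Longrightarrow> \<exists>!u. u \<in> Hom C E Z \<and> u \<cdot> q = h"
    using HomD[OF f] HomD[OF q] by (auto simp: is_cokernel_def)
  have "epi_arr C q"
    unfolding epi_arr_def
  proof (intro conjI allI ballI impI)
    show "q \<in> Arr C" using q by (simp add: Hom_def)
    fix Z g h
    assume "g \<in> Hom C (Tgt C q) Z" "h \<in> Hom C (Tgt C q) Z" and eq: "g \<cdot> q = h \<cdot> q"
    then have gh: "g \<in> Hom C E Z" "h \<in> Hom C E Z" using HomD(3)[OF q] by simp_all
    have "(g \<cdot> q) \<cdot> f = Zero C X Z" using Zero_Comp_right[OF f q gh(1) z] .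
    then have "\<exists>!u. u \<in> Hom C E Z \<and> u \<cdot> q = g \<cdot> q" using ext[OF Comp_in[OF q gh(1)]] by simp
    then show "g = h" using gh eq by (elim ex1E) metis
  qed
  then show ?R using z ext by (blast dest: ex1_implies_ex)
next
  assume R: ?R
  then have "epi_arr C q" by blast
  note uniq = epi_cancel[OF this q]
  have "\<exists>!u. u \<in> Hom C E Z \<and> u \<cdot> q = h" if h: "h \<in> Hom C Y Z" "h \<cdot> f = Zero C X Z" for Z h
  proof -
    obtain u where "u \<in> Hom C E Z" "u \<cdot> q = h" using R h by blast
    then show ?thesis using uniq by metis
  qed
  then show ?L using R HomD[OF f] HomD[OF q] by (simp add: is_cokernel_def)
qed

lemma is_kernel_Hom: "\<lbrakk>is_kernel C f k; f \<in> Hom C X Y\<rbrakk> \<Longrightarrow> k \<in> Hom C (Src C k) X"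
  by (auto simp: is_kernel_def Hom_def)

lemma is_cokernel_Hom: "\<lbrakk>is_cokernel C f q; f \<in> Hom C X Y\<rbrakk> \<Longrightarrow> q \<in> Hom C Y (Tgt C q)"
  by (auto simp: is_cokernel_def Hom_def)

lemma is_kernelD:
  assumes "is_kernel C f k" "f \<in> Hom C X Y" "k \<in> Hom C K X"
  shows "f \<cdot> k = Zero C K Y" and "mono_arr C k"
    and "\<And>W h. \<lbrakk>h \<in> Hom C W X; f \<cdot> h = Zero C W Y\<rbrakk> \<Longrightarrow> \<exists>u \<in> Hom C W K. k \<cdot> u = h"
  using assms(1) is_kernel_iff[OF assms(2,3)] by simp_all

lemma is_cokernelD:
  assumes "is_cokernel C f q" "f \<in> Hom C X Y" "q \<in> Hom C Y E"
  shows "q \<cdot> f = Zero C X E" and "epi_arr C q"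
    and "\<And>Z h. \<lbrakk>h \<in> Hom C Y Z; h \<cdot> f = Zero C X Z\<rbrakk> \<Longrightarrow> \<exists>u \<in> Hom C E Z. u \<cdot> q = h"
  using assms(1) is_cokernel_iff[OF assms(2,3)] by simp_all

lemma is_kernel_mono_postcomposite:
  assumes f: "f \<in> Hom C X Y" and m: "m \<in> Hom C Y Z" "mono_arr C m" and k: "k \<in> Hom C K X"
  shows "is_kernel C (m \<cdot> f) k \<longleftrightarrow> is_kernel C f k"
proof -
  have *: "(m \<cdot> f) \<cdot> h = Zero C W Z \<longleftrightarrow> f \<cdot> h = Zero C W Y" if h: "h \<in> Hom C W X" for W h
  proof -
    have "(m \<cdot> f) \<cdot> h = m \<cdot> (f \<cdot> h)" using Comp_assoc[OF h f m(1)] .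
    then show ?thesis
      using mono_cancel_Zero[OF m(2,1) Comp_in[OF h f]] Comp_Zero[OF m(1) Hom_Src_in[OF h]] by metis
  qed
  show ?thesis
    unfolding is_kernel_iff[OF f k] is_kernel_iff[OF Comp_in[OF f m(1)] k] by (simp add: * k)
qed

text \<open>A cokernel of a zero arrow is split mono: the identity factors through it.\<close>

lemma cokernel_of_Zero_is_mono:
  assumes q: "is_cokernel C (Zero C X Y) q" and "X \<in> Obj C" "Y \<in> Obj C"
  shows "mono_arr C q"
proof -
  have z: "Zero C X Y \<in> Hom C X Y" using Zero_in assms by blast
  have qH: "q \<in> Hom C Y (Tgt C q)" using is_cokernel_Hom[OF q z] .
  have "Ident C Y \<cdot> Zero C X Y = Zero C X Y" using Ident_Comp[OF z] .
  then obtain r where "r \<in> Hom C (Tgt C q) Y" "r \<cdot> q = Ident C Y"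
    using is_cokernelD(3)[OF q z qH Ident_in[OF assms(3)]] by blast
  then show ?thesis using mono_if_retraction qH by blast
qed

lemma kernel_of_Zero_is_epi:
  assumes k: "is_kernel C (Zero C X Y) k" and "X \<in> Obj C" "Y \<in> Obj C"
  shows "epi_arr C k"
proof -
  have z: "Zero C X Y \<in> Hom C X Y" using Zero_in assms by blast
  have kH: "k \<in> Hom C (Src C k) X" using is_kernel_Hom[OF k z] .
  have "Zero C X Y \<cdot> Ident C X = Zero C X Y" using Comp_Ident[OF z] .
  then obtain r where "r \<in> Hom C X (Src C k)" "k \<cdot> r = Ident C X"
    using is_kernelD(3)[OF k z kH Ident_in[OF assms(2)]] by blast
  then show ?thesis using epi_if_section kH by blast
qed

lemma mono_if_exact_Zero:
  assumes ex: "exact C (Zero C Z X) f" and f: "f \<in> Hom C X Y" and Z: "Z \<in> Obj C"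
  shows "mono_arr C f"
proof -
  have X: "X \<in> Obj C" using f Hom_Src_in by blast
  then have z: "Zero C Z X \<in> Hom C Z X" using Zero_in Z by blast
  obtain q k where q: "is_cokernel C (Zero C Z X) q" and qk: "is_kernel C q k"
    and fk: "is_kernel C f k" using ex by (auto simp: exact_def)
  have qH: "q \<in> Hom C X (Tgt C q)" using is_cokernel_Hom[OF q z] .
  have kH: "k \<in> Hom C (Src C k) X" using is_kernel_Hom[OF qk qH] .
  have k0: "k = Zero C (Src C k) X"
    using mono_cancel_Zero[OF cokernel_of_Zero_is_mono[OF q Z X] qH kH]
      is_kernelD(1)[OF qk qH kH] by blast
  show ?thesis
  proof (rule mono_if_cancel_Zero[OF f])
    fix W h assume h: "h \<in> Hom C W X" "f \<cdot> h = Zero C W Y"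
    then obtain u where "u \<in> Hom C W (Src C k)" "k \<cdot> u = h"
      using is_kernelD(3)[OF fk f kH] by blast
    then show "h = Zero C W X" using k0 Zero_Comp[of u W "Src C k" X] X by metis
  qed
qed

lemma epi_if_exact_Zero:
  assumes ex: "exact C f (Zero C Y Z)" and f: "f \<in> Hom C X Y" and Z: "Z \<in> Obj C"
  shows "epi_arr C f"
proof -
  have Y: "Y \<in> Obj C" using f Hom_Tgt_in by blast
  then have z: "Zero C Y Z \<in> Hom C Y Z" using Zero_in Z by blast
  obtain q k where q: "is_cokernel C f q" and qk: "is_kernel C q k"
    and zk: "is_kernel C (Zero C Y Z) k" using ex by (auto simp: exact_def)
  have qH: "q \<in> Hom C Y (Tgt C q)" using is_cokernel_Hom[OF q f] .
  have kH: "k \<in> Hom C (Src C k) Y" using is_kernel_Hom[OF qk qH] .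
  have q0: "q = Zero C Y (Tgt C q)"
    using epi_cancel_Zero[OF kernel_of_Zero_is_epi[OF zk Y Z] kH qH]
      is_kernelD(1)[OF qk qH kH] by blast
  show ?thesis
  proof (rule epi_if_cancel_Zero[OF f])
    fix W h assume h: "h \<in> Hom C Y W" "h \<cdot> f = Zero C X W"
    then obtain u where "u \<in> Hom C (Tgt C q) W" "u \<cdot> q = h"
      using is_cokernelD(3)[OF q f qH] by blast
    then show "h = Zero C Y W" using q0 Comp_Zero[of u "Tgt C q" W Y] Y by metis
  qed
qed

end


section \<open>Abelian categories\<close>

context abelian_category
begin

lemma zero_object_zero_obj: "zero_object C (zero_obj C)"
  unfolding zero_obj_def using has_zero by (rule someI_ex)

lemma zero_obj_in: "zero_obj C \<in> Obj C"
  using zero_object_zero_obj by (simp add: zero_object_def)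

lemma Hom_to_zero_obj: "f \<in> Hom C X (zero_obj C) \<Longrightarrow> f = Zero C X (zero_obj C)"
  using zero_object_zero_obj Zero_in Hom_Src_in zero_obj_in unfolding zero_object_def by metis

lemma Hom_from_zero_obj: "f \<in> Hom C (zero_obj C) X \<Longrightarrow> f = Zero C (zero_obj C) X"
  using zero_object_zero_obj Zero_in Hom_Tgt_in zero_obj_in unfolding zero_object_def by metis

lemma is_kernel_ker: "f \<in> Hom C X Y \<Longrightarrow> is_kernel C f (ker C f)"
  unfolding ker_def using has_kernels[of f] HomD(1) by (metis someI_ex)

lemma is_cokernel_coker: "f \<in> Hom C X Y \<Longrightarrow> is_cokernel C f (coker C f)"
  unfolding coker_def using has_cokernels[of f] HomD(1) by (metis someI_ex)

lemma ker_in: "f \<in> Hom C X Y \<Longrightarrow> ker C f \<in> Hom C (Src C (ker C f)) X"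
  using is_kernel_ker is_kernel_Hom by blast

lemma coker_in: "f \<in> Hom C X Y \<Longrightarrow> coker C f \<in> Hom C Y (Tgt C (coker C f))"
  using is_cokernel_coker is_cokernel_Hom by blast

lemma ker_props:
  assumes f: "f \<in> Hom C X Y"
  shows "f \<cdot> ker C f = Zero C (Src C (ker C f)) Y" and "mono_arr C (ker C f)"
    and "\<And>W h. \<lbrakk>h \<in> Hom C W X; f \<cdot> h = Zero C W Y\<rbrakk>
      \<Longrightarrow> \<exists>u \<in> Hom C W (Src C (ker C f)). ker C f \<cdot> u = h"
  using is_kernelD[OF is_kernel_ker[OF f] f ker_in[OF f]] by blast+

lemma coker_props:
  assumes f: "f \<in> Hom C X Y"
  shows "coker C f \<cdot> f = Zero C X (Tgt C (coker C f))" and "epi_arr C (coker C f)"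
    and "\<And>Z h. \<lbrakk>h \<in> Hom C Y Z; h \<cdot> f = Zero C X Z\<rbrakk>
      \<Longrightarrow> \<exists>u \<in> Hom C (Tgt C (coker C f)) Z. u \<cdot> coker C f = h"
  using is_cokernelD[OF is_cokernel_coker[OF f] f coker_in[OF f]] by blast+

lemma ker_map_props:
  assumes f: "f \<in> Hom C X Y" and f': "f' \<in> Hom C X' Y'" and a: "a \<in> Hom C X X'"
    and z: "f' \<cdot> (a \<cdot> ker C f) = Zero C (Src C (ker C f)) Y'"
  shows "ker_map C f f' a \<in> Hom C (Src C (ker C f)) (Src C (ker C f'))"
    and "ker C f' \<cdot> ker_map C f f' a = a \<cdot> ker C f"
proof -
  have "\<exists>u \<in> Hom C (Src C (ker C f)) (Src C (ker C f')). ker C f' \<cdot> u = a \<cdot> ker C f"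
    using ker_props(3)[OF f' Comp_in[OF ker_in[OF f] a] z] .
  then have "\<exists>!u. u \<in> Hom C (Src C (ker C f)) (Src C (ker C f')) \<and> ker C f' \<cdot> u = a \<cdot> ker C f"
    using mono_cancel[OF ker_props(2)[OF f'] ker_in[OF f']] by metis
  from theI'[OF this] show "ker_map C f f' a \<in> Hom C (Src C (ker C f)) (Src C (ker C f'))"
    and "ker C f' \<cdot> ker_map C f f' a = a \<cdot> ker C f"
    unfolding ker_map_def by blast+
qed

lemma coker_map_props:
  assumes f: "f \<in> Hom C X Y" and f': "f' \<in> Hom C X' Y'" and b: "b \<in> Hom C Y Y'"
    and z: "(coker C f' \<cdot> b) \<cdot> f = Zero C X (Tgt C (coker C f'))"
  shows "coker_map C f f' b \<in> Hom C (Tgt C (coker C f)) (Tgt C (coker C f'))"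
    and "coker_map C f f' b \<cdot> coker C f = coker C f' \<cdot> b"
proof -
  have "\<exists>u \<in> Hom C (Tgt C (coker C f)) (Tgt C (coker C f')). u \<cdot> coker C f = coker C f' \<cdot> b"
    using coker_props(3)[OF f Comp_in[OF b coker_in[OF f']] z] .
  then have "\<exists>!u. u \<in> Hom C (Tgt C (coker C f)) (Tgt C (coker C f')) \<and>
      u \<cdot> coker C f = coker C f' \<cdot> b"
    using epi_cancel[OF coker_props(2)[OF f] coker_in[OF f]] by metis
  from theI'[OF this] show "coker_map C f f' b \<in> Hom C (Tgt C (coker C f)) (Tgt C (coker C f'))"
    and "coker_map C f f' b \<cdot> coker C f = coker C f' \<cdot> b"
    unfolding coker_map_def by blast+
qed

text \<open>An epimorphism is a cokernel of some arrow \<open>f\<close>; as \<open>f\<close> factors through the kernel of the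
  epimorphism, an arrow that vanishes on that kernel also vanishes on \<open>f\<close>.\<close>

lemma epi_is_cokernel_of_kernel:
  assumes e: "epi_arr C e" "e \<in> Hom C X Y" and k: "is_kernel C e k"
  shows "is_cokernel C k e"
proof -
  have kH: "k \<in> Hom C (Src C k) X" using is_kernel_Hom[OF k e(2)] .
  obtain f where f: "is_cokernel C f e" using epi_is_cokernel[OF e(1)] by blast
  then have fH: "f \<in> Hom C (Src C f) X" using HomD(2)[OF e(2)]
    by (auto simp: is_cokernel_def Hom_def)
  note ck = is_cokernelD[OF f fH e(2)]
  obtain t where t: "t \<in> Hom C (Src C f) (Src C k)" "k \<cdot> t = f"
    using is_kernelD(3)[OF k e(2) kH fH ck(1)] by blast
  have "\<exists>u \<in> Hom C Y Z. u \<cdot> e = h"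
    if h: "h \<in> Hom C X Z" "h \<cdot> k = Zero C (Src C k) Z" for Z h
    using ck(3)[OF h(1)] Zero_Comp_left[OF t(1) kH h(1,2)] t(2) by metis
  then show ?thesis
    using is_cokernel_iff[OF kH e(2)] is_kernelD(1)[OF k e(2) kH] e(1) by blast
qed

lemma mono_is_kernel_of_cokernel:
  assumes e: "mono_arr C e" "e \<in> Hom C X Y" and q: "is_cokernel C e q"
  shows "is_kernel C q e"
proof -
  have qH: "q \<in> Hom C Y (Tgt C q)" using is_cokernel_Hom[OF q e(2)] .
  obtain f where f: "is_kernel C f e" using mono_is_kernel[OF e(1)] by blast
  then have fH: "f \<in> Hom C Y (Tgt C f)" using HomD(3)[OF e(2)]
    by (auto simp: is_kernel_def Hom_def)
  note kf = is_kernelD[OF f fH e(2)]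
  obtain t where t: "t \<in> Hom C (Tgt C q) (Tgt C f)" "t \<cdot> q = f"
    using is_cokernelD(3)[OF q e(2) qH fH kf(1)] by blast
  have "\<exists>u \<in> Hom C W X. e \<cdot> u = h"
    if h: "h \<in> Hom C W Y" "q \<cdot> h = Zero C W (Tgt C q)" for W h
    using kf(3)[OF h(1)] Zero_Comp_right[OF h(1) qH t(1) h(2)] t(2) by metis
  then show ?thesis
    using is_kernel_iff[OF qH e(2)] is_cokernelD(1)[OF q e(2) qH] e(1) by blast
qed

text \<open>An arrow \<open>f = m e\<close>, with \<open>m\<close> the kernel of the cokernel of \<open>f\<close>, cannot factor through a
  subobject of the image smaller than \<open>m\<close>: such a subobject is again a kernel, of an arrow that
  kills \<open>f\<close>, hence kills \<open>m\<close>. Applied to the kernel of an arrow \<open>u\<close> with \<open>u e = 0\<close> this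
  makes \<open>u\<close> vanish.\<close>

lemma epi_onto_image:
  assumes f: "f \<in> Hom C X Y" and q: "is_cokernel C f q" and m: "is_kernel C q m"
    and mH: "m \<in> Hom C M Y" and e: "e \<in> Hom C X M" "m \<cdot> e = f"
  shows "epi_arr C e"
proof (rule epi_if_cancel_Zero[OF e(1)])
  have qH: "q \<in> Hom C Y (Tgt C q)" using is_cokernel_Hom[OF q f] .
  note km = is_kernelD[OF m qH mH]
  fix Z u assume u: "u \<in> Hom C M Z" "u \<cdot> e = Zero C X Z"
  let ?j = "ker C u"
  let ?J = "Src C ?j"
  have j: "?j \<in> Hom C ?J M" using ker_in[OF u(1)] .
  obtain e' where e': "e' \<in> Hom C X ?J" "?j \<cdot> e' = e"
    using ker_props(3)[OF u(1) e(1) u(2)] by blast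
  have mj: "m \<cdot> ?j \<in> Hom C ?J Y" using Comp_in[OF j mH] .
  have "mono_arr C (m \<cdot> ?j)" using mono_Comp[OF ker_props(2)[OF u(1)] km(2) j mH] .
  then obtain x where x: "is_kernel C x (m \<cdot> ?j)" using mono_is_kernel by blast
  then have xH: "x \<in> Hom C Y (Tgt C x)" using HomD(3)[OF mj]
    by (auto simp: is_kernel_def Hom_def)
  note kx = is_kernelD[OF x xH mj]
  have "(m \<cdot> ?j) \<cdot> e' = f" using Comp_assoc[OF e'(1) j mH] e'(2) e(2) by simp
  then have "x \<cdot> f = Zero C X (Tgt C x)" using Zero_Comp_left[OF e'(1) mj xH kx(1)] by simp
  then obtain y where y: "y \<in> Hom C (Tgt C q) (Tgt C x)" "y \<cdot> q = x"
    using is_cokernelD(3)[OF q f qH xH] by blast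
  have "x \<cdot> m = Zero C M (Tgt C x)" using Zero_Comp_right[OF mH qH y(1) km(1)] y(2) by simp
  then obtain t where t: "t \<in> Hom C M ?J" "(m \<cdot> ?j) \<cdot> t = m" using kx(3)[OF mH] by blast
  have M: "M \<in> Obj C" using Hom_Src_in[OF mH] .
  have "m \<cdot> (?j \<cdot> t) = m \<cdot> Ident C M" using t(2) Comp_assoc[OF t(1) j mH] Comp_Ident[OF mH] by simp
  then have "?j \<cdot> t = Ident C M"
    using mono_cancel[OF km(2) mH Comp_in[OF t(1) j] Ident_in[OF M]] by blast
  then have "u = u \<cdot> (?j \<cdot> t)" using Comp_Ident[OF u(1)] by simp
  also have "\<dots> = Zero C M Z" using Zero_Comp_left[OF t(1) j u(1) ker_props(1)[OF u(1)]] .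
  finally show "u = Zero C M Z" .
qed

lemma image_factorization:
  assumes f: "f \<in> Hom C X Y"
  obtains M m e where "m \<in> Hom C M Y" "e \<in> Hom C X M" "m \<cdot> e = f" "mono_arr C m" "epi_arr C e"
    "is_kernel C (coker C f) m"
proof -
  let ?q = "coker C f" let ?m = "ker C ?q"
  have q: "is_cokernel C f ?q" "?q \<in> Hom C Y (Tgt C ?q)"
    using is_cokernel_coker[OF f] coker_in[OF f] by blast+
  note m = is_kernel_ker[OF q(2)] ker_in[OF q(2)]
  obtain e where e: "e \<in> Hom C X (Src C ?m)" "?m \<cdot> e = f"
    using is_kernelD(3)[OF m(1) q(2) m(2) f is_cokernelD(1)[OF q(1) f q(2)]] by blast
  show ?thesis
    using that[OF m(2) e is_kernelD(2)[OF m(1) q(2) m(2)] epi_onto_image[OF f q(1) m e] m(1)] .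
qed

text \<open>The pullback of an epimorphism \<open>q\<close> along the kernel \<open>k\<close> of \<open>g\<close> is an epimorphism, because
  \<open>k\<close> is the image of \<open>q \<alpha>\<close>. Indeed, factor \<open>g q = m e\<close> with \<open>m\<close> mono and \<open>e\<close> epi. Since \<open>e\<close>
  kills the kernel of \<open>q\<close>, it factors as \<open>e = e' q\<close>, and then \<open>e'\<close> is both a cokernel of \<open>q \<alpha>\<close>
  and an arrow with the same kernel as \<open>g = m e'\<close>.\<close>

lemma kernel_of_composite_epi:
  assumes q: "q \<in> Hom C X Y" "epi_arr C q" and g: "g \<in> Hom C Y Z"
    and a: "is_kernel C (g \<cdot> q) a" "a \<in> Hom C L X"
    and k: "is_kernel C g k" "k \<in> Hom C K Y"
    and b: "b \<in> Hom C L K" "k \<cdot> b = q \<cdot> a"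
  shows "epi_arr C b"
proof -
  have gq: "g \<cdot> q \<in> Hom C X Z" using Comp_in[OF q(1) g] .
  obtain M m e where m: "m \<in> Hom C M Z" "mono_arr C m" and e: "e \<in> Hom C X M" "epi_arr C e"
    and me: "m \<cdot> e = g \<cdot> q" using image_factorization[OF gq] by metis
  have ea: "is_kernel C e a" using is_kernel_mono_postcomposite[OF e(1) m a(2)] a(1) me by simp
  have ea0: "e \<cdot> a = Zero C L M" using is_kernelD(1)[OF ea e(1) a(2)] .
  have cok_e: "is_cokernel C a e" using epi_is_cokernel_of_kernel[OF e(2,1) ea] .
  let ?n = "ker C q" let ?N = "Src C ?n"
  have n: "?n \<in> Hom C ?N X" "q \<cdot> ?n = Zero C ?N Y"
    using ker_in[OF q(1)] ker_props(1)[OF q(1)] .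
  have cok_q: "is_cokernel C ?n q" using epi_is_cokernel_of_kernel[OF q(2,1) is_kernel_ker[OF q(1)]] .
  have "(g \<cdot> q) \<cdot> ?n = Zero C ?N Z" using Zero_Comp_right[OF n(1) q(1) g n(2)] .
  then obtain n' where n': "n' \<in> Hom C ?N L" "a \<cdot> n' = ?n"
    using is_kernelD(3)[OF a(1) gq a(2) n(1)] by blast
  have "e \<cdot> ?n = Zero C ?N M" using Zero_Comp_left[OF n'(1) a(2) e(1) ea0] n'(2) by simp
  then obtain e' where e': "e' \<in> Hom C Y M" "e' \<cdot> q = e"
    using is_cokernelD(3)[OF cok_q n(1) q(1) e(1)] by blast
  have "(m \<cdot> e') \<cdot> q = g \<cdot> q" using Comp_assoc[OF q(1) e'(1) m(1)] e'(2) me by simp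
  then have "m \<cdot> e' = g" using epi_cancel[OF q(2,1) Comp_in[OF e'(1) m(1)] g] by blast
  then have ker_e': "is_kernel C e' k"
    using is_kernel_mono_postcomposite[OF e'(1) m k(2)] k(1) by simp
  have qa: "q \<cdot> a \<in> Hom C L Y" using Comp_in[OF a(2) q(1)] .
  have e'z: "e' \<cdot> (q \<cdot> a) = Zero C L M" using Comp_assoc[OF a(2) q(1) e'(1)] e'(2) ea0 by simp
  have epi_e': "epi_arr C e'"
  proof (rule epi_if_cancel_Zero[OF e'(1)])
    fix W h assume h: "h \<in> Hom C M W" "h \<cdot> e' = Zero C Y W"
    have "h \<cdot> e = Zero C X W"
      using Comp_assoc[OF q(1) e'(1) h(1)] h(2) e'(2) Zero_Comp[OF q(1)] Hom_Tgt_in[OF h(1)] by simp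
    then show "h = Zero C M W" using epi_cancel_Zero[OF e(2,1) h(1)] by blast
  qed
  have "\<exists>u \<in> Hom C M W. u \<cdot> e' = h"
    if h: "h \<in> Hom C Y W" "h \<cdot> (q \<cdot> a) = Zero C L W" for W h
  proof -
    have hq: "h \<cdot> q \<in> Hom C X W" using Comp_in[OF q(1) h(1)] .
    have "(h \<cdot> q) \<cdot> a = Zero C L W" using Comp_assoc[OF a(2) q(1) h(1)] h(2) by simp
    then obtain u where u: "u \<in> Hom C M W" "u \<cdot> e = h \<cdot> q"
      using is_cokernelD(3)[OF cok_e a(2) e(1) hq] by blast
    then have "(u \<cdot> e') \<cdot> q = h \<cdot> q" using Comp_assoc[OF q(1) e'(1) u(1)] e'(2) by simp
    then have "u \<cdot> e' = h" using epi_cancel[OF q(2,1) Comp_in[OF e'(1) u(1)] h(1)] by blast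
    then show ?thesis using u(1) by blast
  qed
  then have "is_cokernel C (q \<cdot> a) e'" using is_cokernel_iff[OF qa e'(1)] e'z epi_e' by blast
  then show ?thesis using epi_onto_image[OF qa _ ker_e' k(2) b] by blast
qed

text \<open>A cokernel \<open>q\<close> of \<open>c\<close> restricts to a cokernel between the kernels of \<open>g q\<close> and \<open>g\<close>. The
  restriction \<open>b\<close> is epi by the previous lemma, so it is the cokernel of its kernel. That kernel
  is the kernel of \<open>q\<close>, seen inside \<open>L\<close>; since it is the image of \<open>c\<close>, it is also the image of
  \<open>t\<close>.\<close>

lemma restricted_cokernel:
  assumes c: "c \<in> Hom C S X" and q: "is_cokernel C c q" "q \<in> Hom C X Y" and g: "g \<in> Hom C Y Z"
    and a: "is_kernel C (g \<cdot> q) a" "a \<in> Hom C L X"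
    and k: "is_kernel C g k" "k \<in> Hom C K Y"
    and t: "t \<in> Hom C S L" "a \<cdot> t = c"
    and b: "b \<in> Hom C L K" "k \<cdot> b = q \<cdot> a"
  shows "is_cokernel C t b"
proof -
  have gq: "g \<cdot> q \<in> Hom C X Z" using Comp_in[OF q(2) g] .
  note cq = is_cokernelD[OF q(1) c q(2)]
  note ka = is_kernelD[OF a(1) gq a(2)] and kk = is_kernelD[OF k(1) g k(2)]
  have epi_b: "epi_arr C b" using kernel_of_composite_epi[OF q(2) cq(2) g a k b] .
  have "k \<cdot> (b \<cdot> t) = Zero C S Y"
    using Comp_assoc[OF t(1) b(1) k(2)] Comp_assoc[OF t(1) a(2) q(2)] b(2) t(2) cq(1) by simp
  then have bt: "b \<cdot> t = Zero C S K"
    using mono_cancel_Zero[OF kk(2) k(2) Comp_in[OF t(1) b(1)]] by blast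
  \<comment> \<open>\<open>n\<close> is the image of \<open>c\<close>, and \<open>n'\<close> is \<open>n\<close> regarded as a subobject of \<open>L\<close>.\<close>
  let ?n = "ker C q" let ?N = "Src C ?n"
  have n: "?n \<in> Hom C ?N X" "q \<cdot> ?n = Zero C ?N Y"
    using ker_in[OF q(2)] ker_props(1)[OF q(2)] .
  obtain c' where c': "c' \<in> Hom C S ?N" "?n \<cdot> c' = c"
    using ker_props(3)[OF q(2) c cq(1)] by blast
  have epi_c': "epi_arr C c'" using epi_onto_image[OF c q(1) is_kernel_ker[OF q(2)] n(1) c'] .
  have "(g \<cdot> q) \<cdot> ?n = Zero C ?N Z" using Zero_Comp_right[OF n(1) q(2) g n(2)] .
  then obtain n' where n': "n' \<in> Hom C ?N L" "a \<cdot> n' = ?n" using ka(3)[OF n(1)] by blast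
  have "a \<cdot> (n' \<cdot> c') = a \<cdot> t" using Comp_assoc[OF c'(1) n'(1) a(2)] n'(2) c'(2) t(2) by simp
  then have n'c': "n' \<cdot> c' = t"
    using mono_cancel[OF ka(2) a(2) Comp_in[OF c'(1) n'(1)] t(1)] by blast
  let ?m = "ker C b" let ?M = "Src C ?m"
  have m: "?m \<in> Hom C ?M L" "b \<cdot> ?m = Zero C ?M K"
    using ker_in[OF b(1)] ker_props(1)[OF b(1)] .
  have cok_b: "is_cokernel C ?m b" using epi_is_cokernel_of_kernel[OF epi_b b(1) is_kernel_ker[OF b(1)]] .
  have "q \<cdot> (a \<cdot> ?m) = Zero C ?M Y"
    using Zero_Comp_right[OF m(1) b(1) k(2) m(2)] Comp_assoc[OF m(1) a(2) q(2)] b(2) by simp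
  then obtain x where x: "x \<in> Hom C ?M ?N" "?n \<cdot> x = a \<cdot> ?m"
    using ker_props(3)[OF q(2) Comp_in[OF m(1) a(2)]] by blast
  have "a \<cdot> (n' \<cdot> x) = a \<cdot> ?m" using Comp_assoc[OF x(1) n'(1) a(2)] n'(2) x(2) by simp
  then have n'x: "n' \<cdot> x = ?m"
    using mono_cancel[OF ka(2) a(2) Comp_in[OF x(1) n'(1)] m(1)] by blast
  have "\<exists>u \<in> Hom C K W. u \<cdot> b = h"
    if h: "h \<in> Hom C L W" "h \<cdot> t = Zero C S W" for W h
  proof -
    have "(h \<cdot> n') \<cdot> c' = Zero C S W" using Comp_assoc[OF c'(1) n'(1) h(1)] n'c' h(2) by simp
    then have "h \<cdot> n' = Zero C ?N W"
      using epi_cancel_Zero[OF epi_c' c'(1) Comp_in[OF n'(1) h(1)]] by blast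
    then have "h \<cdot> ?m = Zero C ?M W" using Zero_Comp_left[OF x(1) n'(1) h(1)] n'x by simp
    then show ?thesis using is_cokernelD(3)[OF cok_b m(1) b(1) h(1)] by blast
  qed
  then show ?thesis using is_cokernel_iff[OF t(1) b(1)] bt epi_b by blast
qed

lemma exact_cokernel:
  assumes f: "f \<in> Hom C X Y" and q: "is_cokernel C f q"
  shows "exact C f q"
  unfolding exact_def using q is_kernel_ker[OF is_cokernel_Hom[OF q f]] by blast

lemma exact_kernel:
  assumes f: "f \<in> Hom C X Y" and k: "is_kernel C f k"
  shows "exact C k f"
proof -
  have kH: "k \<in> Hom C (Src C k) X" using is_kernel_Hom[OF k f] .
  show ?thesis unfolding exact_def
    using k is_cokernel_coker[OF kH]
      mono_is_kernel_of_cokernel[OF is_kernelD(2)[OF k f kH] kH is_cokernel_coker[OF kH]] by blast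
qed

lemma exact_epi_Zero:
  assumes e: "epi_arr C e" "e \<in> Hom C X Y"
  shows "exact C e (Zero C Y (zero_obj C))"
proof -
  have X: "X \<in> Obj C" and Y: "Y \<in> Obj C" using Hom_Src_in[OF e(2)] Hom_Tgt_in[OF e(2)] .
  let ?z = "Zero C Y (zero_obj C)"
  have z: "?z \<in> Hom C Y (zero_obj C)" using Zero_in[OF Y zero_obj_in] .
  have "epi_arr C ?z"
  proof (rule epi_if_cancel_Zero[OF z])
    fix Z h assume "h \<in> Hom C (zero_obj C) Z"
    then show "h = Zero C (zero_obj C) Z" by (rule Hom_from_zero_obj)
  qed
  moreover have "\<exists>u \<in> Hom C (zero_obj C) Z. u \<cdot> ?z = h"
    if h: "h \<in> Hom C Y Z" "h \<cdot> e = Zero C X Z" for Z h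
    using epi_cancel_Zero[OF e h] Zero_in[OF zero_obj_in Hom_Tgt_in[OF h(1)]] Comp_Zero Y by metis
  ultimately have "is_cokernel C e ?z"
    using is_cokernel_iff[OF e(2) z] Zero_Comp[OF e(2) zero_obj_in] by blast
  then show ?thesis using exact_cokernel[OF e(2)] by blast
qed

lemma exact_Zero_mono:
  assumes m: "mono_arr C m" "m \<in> Hom C X Y"
  shows "exact C (Zero C (zero_obj C) X) m"
proof -
  have X: "X \<in> Obj C" and Y: "Y \<in> Obj C" using Hom_Src_in[OF m(2)] Hom_Tgt_in[OF m(2)] .
  let ?z = "Zero C (zero_obj C) X"
  have z: "?z \<in> Hom C (zero_obj C) X" using Zero_in[OF zero_obj_in X] .
  have "mono_arr C ?z"
  proof (rule mono_if_cancel_Zero[OF z])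
    fix Z h assume "h \<in> Hom C Z (zero_obj C)"
    then show "h = Zero C Z (zero_obj C)" by (rule Hom_to_zero_obj)
  qed
  moreover have "\<exists>u \<in> Hom C Z (zero_obj C). ?z \<cdot> u = h"
    if h: "h \<in> Hom C Z X" "m \<cdot> h = Zero C Z Y" for Z h
    using mono_cancel_Zero[OF m h] Zero_in[OF Hom_Src_in[OF h(1)] zero_obj_in] Zero_Comp X by metis
  ultimately have "is_kernel C m ?z"
    using is_kernel_iff[OF m(2) z] Comp_Zero[OF m(2) zero_obj_in] by blast
  then show ?thesis using exact_kernel[OF m(2)] by blast
qed

lemma exact_Comp_Zero:
  assumes ex: "exact C f g" and f: "f \<in> Hom C X Y" and g: "g \<in> Hom C Y Z"
  shows "g \<cdot> f = Zero C X Z"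
proof -
  obtain q k where q: "is_cokernel C f q" and qk: "is_kernel C q k" and gk: "is_kernel C g k"
    using ex by (auto simp: exact_def)
  have qH: "q \<in> Hom C Y (Tgt C q)" using is_cokernel_Hom[OF q f] .
  have kH: "k \<in> Hom C (Src C k) Y" using is_kernel_Hom[OF qk qH] .
  obtain e where e: "e \<in> Hom C X (Src C k)" "k \<cdot> e = f"
    using is_kernelD(3)[OF qk qH kH f is_cokernelD(1)[OF q f qH]] by blast
  show ?thesis using Zero_Comp_left[OF e(1) kH g is_kernelD(1)[OF gk g kH]] e(2) by simp
qed

text \<open>By exactness, an arrow \<open>h\<close> with \<open>h f = 0\<close> is defined on the image of \<open>g\<close>, and injectivity of
  its target extends it from there to the whole target of \<open>g\<close>.\<close>

lemma injective_extend_exact: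
  assumes ex: "exact C f g" and f: "f \<in> Hom C X Y" and g: "g \<in> Hom C Y Z"
    and I: "injective_obj C I" and h: "h \<in> Hom C Y I" "h \<cdot> f = Zero C X I"
  shows "\<exists>u \<in> Hom C Z I. u \<cdot> g = h"
proof -
  obtain q k where q: "is_cokernel C f q" and qk: "is_kernel C q k" and gk: "is_kernel C g k"
    using ex by (auto simp: exact_def)
  have qH: "q \<in> Hom C Y (Tgt C q)" using is_cokernel_Hom[OF q f] .
  have kH: "k \<in> Hom C (Src C k) Y" using is_kernel_Hom[OF qk qH] .
  obtain x where x: "x \<in> Hom C (Tgt C q) I" "x \<cdot> q = h"
    using is_cokernelD(3)[OF q f qH h] by blast
  have hk: "h \<cdot> k = Zero C (Src C k) I"
    using Zero_Comp_right[OF kH qH x(1) is_kernelD(1)[OF qk qH kH]] x(2) by simp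
  obtain M m e where m: "m \<in> Hom C M Z" "mono_arr C m" and e: "e \<in> Hom C Y M" "epi_arr C e"
    and me: "m \<cdot> e = g" using image_factorization[OF g] by metis
  have ek: "is_kernel C e k" using is_kernel_mono_postcomposite[OF e(1) m kH] gk me by simp
  obtain y where y: "y \<in> Hom C M I" "y \<cdot> e = h"
    using is_cokernelD(3)[OF epi_is_cokernel_of_kernel[OF e(2,1) ek] kH e(1) h(1) hk] by blast
  obtain u where u: "u \<in> Hom C Z I" "u \<cdot> m = y"
    using injective_extend[OF I m(2,1) y(1)] by blast
  have "u \<cdot> g = h" using Comp_assoc[OF e(1) m(1) u(1)] u(2) y(2) me by simp
  then show ?thesis using u(1) by blast
qed

lemma short_exact_injective_splits:
  assumes se: "short_exact C v s" and v: "v \<in> Hom C X Y" and s: "s \<in> Hom C Y Z"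
    and X: "injective_obj C X" and Y: "injective_obj C Y"
  shows "\<exists>t \<in> Hom C Z Y. s \<cdot> t = Ident C Z"
proof -
  have ex: "exact C (Zero C (zero_obj C) X) v" "exact C v s" "exact C s (Zero C Z (zero_obj C))"
    using se HomD[OF v] HomD[OF s] by (simp_all add: short_exact_def)
  have mono: "mono_arr C v" using mono_if_exact_Zero[OF ex(1) v zero_obj_in] .
  have epi: "epi_arr C s" using epi_if_exact_Zero[OF ex(3) s zero_obj_in] .
  have YO: "Y \<in> Obj C" and ZO: "Z \<in> Obj C" using Hom_Src_in[OF s] Hom_Tgt_in[OF s] .
  obtain r where r: "r \<in> Hom C Y X" "r \<cdot> v = Ident C X"
    using injective_extend[OF X mono v Ident_in[OF Hom_Src_in[OF v]]] by blast
  have vr: "v \<cdot> r \<in> Hom C Y Y" using Comp_in[OF r(1) v] .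
  \<comment> \<open>\<open>x\<close> is the idempotent \<open>1 - v r\<close>; it kills \<open>v\<close>, so it factors through \<open>s\<close>.\<close>
  obtain x where x: "x \<in> Hom C Y Y" "Ident C Y = x \<uplus> v \<cdot> r"
    using difference_ex[OF Ident_in[OF YO] vr] by blast
  have "(v \<cdot> r) \<cdot> v = v" using Comp_assoc[OF v r(1) v] r(2) Comp_Ident[OF v] by simp
  then have "x \<cdot> v \<uplus> v = v" using Add_Comp[OF v x(1) vr] x(2) Ident_Comp[OF v] by simp
  then have "x \<cdot> v = Zero C X Y" using Add_eq_right_iff[OF Comp_in[OF v x(1)] v] by blast
  then obtain t where t: "t \<in> Hom C Z Y" "t \<cdot> s = x"
    using injective_extend_exact[OF ex(2) v s Y x(1)] by blast
  have "s \<cdot> (v \<cdot> r) = Zero C Y Z"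
    using Zero_Comp_left[OF r(1) v s exact_Comp_Zero[OF ex(2) v s]] .
  then have "s = s \<cdot> x \<uplus> Zero C Y Z"
    using Comp_Add[OF x(1) vr s] x(2) Comp_Ident[OF s] by simp
  moreover have "s \<cdot> x \<uplus> Zero C Y Z = s \<cdot> x"
  proof -
    interpret comm_group "hom_group C Y Z" using comm_group_hom YO ZO by blast
    show ?thesis using r_one[of "s \<cdot> x"] Comp_in[OF x(1) s] by (simp add: hom_group_def)
  qed
  ultimately have "(s \<cdot> t) \<cdot> s = Ident C Z \<cdot> s"
    using Comp_assoc[OF s t(1) s] t(2) Ident_Comp[OF s] by simp
  then have "s \<cdot> t = Ident C Z"
    using epi_cancel[OF epi s Comp_in[OF t(1) s] Ident_in[OF ZO]] by blast
  then show ?thesis using t(1) by blast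
qed

end


section \<open>Kernels and cokernels of natural transformations\<close>

locale abelian_pair = A: abelian_category A + B: abelian_category B
  for A :: "('a, 'f, 'y) preadditive_scheme" and B :: "('b, 'g, 'z) preadditive_scheme"
begin

abbreviation FC where "FC \<equiv> functor_category A B"

lemma additive_functor_obj:
  "\<lbrakk>additive_functor A B F; X \<in> Obj A\<rbrakk> \<Longrightarrow> obj_map F X \<in> Obj B"
  by (simp add: additive_functor_def is_functor_def)

lemma additive_functor_arr:
  "\<lbrakk>additive_functor A B F; f \<in> Hom A X Y\<rbrakk> \<Longrightarrow> arr_map F f \<in> Hom B (obj_map F X) (obj_map F Y)"
  by (simp add: additive_functor_def is_functor_def)

lemma additive_functor_Ident:
  "\<lbrakk>additive_functor A B F; X \<in> Obj A\<rbrakk> \<Longrightarrow> arr_map F (Ident A X) = Ident B (obj_map F X)"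
  by (simp add: additive_functor_def is_functor_def)

lemma additive_functor_Comp:
  "\<lbrakk>additive_functor A B F; f \<in> Hom A X Y; g \<in> Hom A Y Z\<rbrakk>
    \<Longrightarrow> arr_map F (g \<cdot>\<^bsub>A\<^esub> f) = arr_map F g \<cdot>\<^bsub>B\<^esub> arr_map F f"
  unfolding additive_functor_def is_functor_def by blast

lemma additive_functor_Add:
  "\<lbrakk>additive_functor A B F; f \<in> Hom A X Y; g \<in> Hom A X Y\<rbrakk>
    \<Longrightarrow> arr_map F (f \<uplus>\<^bsub>A\<^esub> g) = arr_map F f \<uplus>\<^bsub>B\<^esub> arr_map F g"
  unfolding additive_functor_def by blast

lemma additive_functor_Zero:
  assumes F: "additive_functor A B F" and X: "X \<in> Obj A" and Y: "Y \<in> Obj A"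
  shows "arr_map F (Zero A X Y) = Zero B (obj_map F X) (obj_map F Y)"
proof -
  have z: "Zero A X Y \<in> Hom A X Y" using A.Zero_in X Y .
  have "arr_map F (Zero A X Y) \<uplus>\<^bsub>B\<^esub> arr_map F (Zero A X Y) = arr_map F (Zero A X Y)"
    using additive_functor_Add[OF F z z] A.Zero_Add[OF z] by simp
  then show ?thesis
    using B.Add_eq_right_iff[OF additive_functor_arr[OF F z] additive_functor_arr[OF F z]] by blast
qed

lemma naturalD:
  assumes "natural A B F G t"
  shows "X \<in> Obj A \<Longrightarrow> t X \<in> Hom B (obj_map F X) (obj_map G X)"
    and "f \<in> Hom A X Y \<Longrightarrow> t Y \<cdot>\<^bsub>B\<^esub> arr_map F f = arr_map G f \<cdot>\<^bsub>B\<^esub> t X"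
  using assms unfolding natural_def by blast+

lemma Hom_FC_iff:
  "t \<in> Hom FC F G \<longleftrightarrow> additive_functor A B F \<and> additive_functor A B G \<and>
    nt_src t = F \<and> nt_tgt t = G \<and> natural A B F G (cmpt t) \<and> cmpt t \<in> extensional (Obj A)"
  by (auto simp: Hom_def functor_category_def)

lemma Hom_FC_D:
  assumes "t \<in> Hom FC F G"
  shows "additive_functor A B F" and "additive_functor A B G" and "nt_src t = F" and "nt_tgt t = G"
    and "X \<in> Obj A \<Longrightarrow> cmpt t X \<in> Hom B (obj_map F X) (obj_map G X)"
    and "f \<in> Hom A X Y \<Longrightarrow> cmpt t Y \<cdot>\<^bsub>B\<^esub> arr_map F f = arr_map G f \<cdot>\<^bsub>B\<^esub> cmpt t X"
    and "cmpt t \<in> extensional (Obj A)"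
  using assms naturalD[of F G "cmpt t"] unfolding Hom_FC_iff by blast+

lemma cmpt_Comp_FC:
  "X \<in> Obj A \<Longrightarrow> cmpt (t \<cdot>\<^bsub>FC\<^esub> s) X = cmpt t X \<cdot>\<^bsub>B\<^esub> cmpt s X"
  by (simp add: functor_category_def)

lemma nat_trans_eqI:
  assumes "t \<in> Hom FC F G" "t' \<in> Hom FC F G" "\<And>X. X \<in> Obj A \<Longrightarrow> cmpt t X = cmpt t' X"
  shows "t = t'"
proof -
  have "cmpt t = cmpt t'"
    using extensionalityI[OF Hom_FC_D(7)[OF assms(1)] Hom_FC_D(7)[OF assms(2)] assms(3)] .
  then show ?thesis
    using Hom_FC_D(3,4)[OF assms(1)] Hom_FC_D(3,4)[OF assms(2)] by (intro nat_trans.equality) simp_all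
qed

lemma Comp_FC_in:
  assumes s: "s \<in> Hom FC F G" and t: "t \<in> Hom FC G H"
  shows "t \<cdot>\<^bsub>FC\<^esub> s \<in> Hom FC F H"
proof -
  have "natural A B F H (\<lambda>X \<in> Obj A. cmpt t X \<cdot>\<^bsub>B\<^esub> cmpt s X)"
    unfolding natural_def
  proof (intro conjI ballI allI)
    fix X assume "X \<in> Obj A"
    then show "(\<lambda>X \<in> Obj A. cmpt t X \<cdot>\<^bsub>B\<^esub> cmpt s X) X \<in> Hom B (obj_map F X) (obj_map H X)"
      using B.Comp_in[OF Hom_FC_D(5)[OF s] Hom_FC_D(5)[OF t]] by simp
  next
    fix X Y f assume f: "f \<in> Hom A X Y"
    have X: "X \<in> Obj A" and Y: "Y \<in> Obj A" using A.Hom_Src_in[OF f] A.Hom_Tgt_in[OF f] .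
    note sX = Hom_FC_D(5)[OF s X] and sY = Hom_FC_D(5)[OF s Y]
    note tX = Hom_FC_D(5)[OF t X] and tY = Hom_FC_D(5)[OF t Y]
    note Ff = additive_functor_arr[OF Hom_FC_D(1)[OF s] f]
    note Gf = additive_functor_arr[OF Hom_FC_D(1)[OF t] f]
    note Hf = additive_functor_arr[OF Hom_FC_D(2)[OF t] f]
    have "(cmpt t Y \<cdot>\<^bsub>B\<^esub> cmpt s Y) \<cdot>\<^bsub>B\<^esub> arr_map F f = arr_map H f \<cdot>\<^bsub>B\<^esub> (cmpt t X \<cdot>\<^bsub>B\<^esub> cmpt s X)"
      using B.Comp_assoc[OF Ff sY tY] B.Comp_assoc[OF sX Gf tY] B.Comp_assoc[OF sX tX Hf]
        Hom_FC_D(6)[OF s f] Hom_FC_D(6)[OF t f] by simp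
    then show "(\<lambda>X \<in> Obj A. cmpt t X \<cdot>\<^bsub>B\<^esub> cmpt s X) Y \<cdot>\<^bsub>B\<^esub> arr_map F f
        = arr_map H f \<cdot>\<^bsub>B\<^esub> (\<lambda>X \<in> Obj A. cmpt t X \<cdot>\<^bsub>B\<^esub> cmpt s X) X"
      using X Y by simp
  qed
  then show ?thesis
    using Hom_FC_D(1,3)[OF s] Hom_FC_D(2,4)[OF t] unfolding Hom_FC_iff
    by (simp add: functor_category_def)
qed

lemma lift_through_mono_nt:
  assumes k: "k \<in> Hom FC K F" and s: "s \<in> Hom FC S F"
    and mono: "\<And>X. X \<in> Obj A \<Longrightarrow> mono_arr B (cmpt k X)"
    and ex: "\<And>X. X \<in> Obj A \<Longrightarrow>
      \<exists>u \<in> Hom B (obj_map S X) (obj_map K X). cmpt k X \<cdot>\<^bsub>B\<^esub> u = cmpt s X"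
  shows "\<exists>u \<in> Hom FC S K. k \<cdot>\<^bsub>FC\<^esub> u = s"
proof -
  have "\<forall>X \<in> Obj A. \<exists>u. u \<in> Hom B (obj_map S X) (obj_map K X) \<and> cmpt k X \<cdot>\<^bsub>B\<^esub> u = cmpt s X"
    using ex by blast
  from bchoice[OF this] obtain u where u: "\<And>X. X \<in> Obj A \<Longrightarrow> u X \<in> Hom B (obj_map S X) (obj_map K X)"
    and ku: "\<And>X. X \<in> Obj A \<Longrightarrow> cmpt k X \<cdot>\<^bsub>B\<^esub> u X = cmpt s X"
    by blast
  define U where "U = \<lparr>nt_src = S, nt_tgt = K, cmpt = restrict u (Obj A)\<rparr>"
  have "u Y \<cdot>\<^bsub>B\<^esub> arr_map S f = arr_map K f \<cdot>\<^bsub>B\<^esub> u X" if f: "f \<in> Hom A X Y" for X Y f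
  proof -
    have X: "X \<in> Obj A" and Y: "Y \<in> Obj A" using A.Hom_Src_in[OF f] A.Hom_Tgt_in[OF f] .
    note Sf = additive_functor_arr[OF Hom_FC_D(1)[OF s] f]
    note Kf = additive_functor_arr[OF Hom_FC_D(1)[OF k] f]
    note Ff = additive_functor_arr[OF Hom_FC_D(2)[OF k] f]
    note kX = Hom_FC_D(5)[OF k X] and kY = Hom_FC_D(5)[OF k Y]
    have "cmpt k Y \<cdot>\<^bsub>B\<^esub> (u Y \<cdot>\<^bsub>B\<^esub> arr_map S f) = cmpt k Y \<cdot>\<^bsub>B\<^esub> (arr_map K f \<cdot>\<^bsub>B\<^esub> u X)"
      using B.Comp_assoc[OF Sf u[OF Y] kY] B.Comp_assoc[OF u[OF X] Kf kY]
        B.Comp_assoc[OF u[OF X] kX Ff] ku[OF X] ku[OF Y] Hom_FC_D(6)[OF s f] Hom_FC_D(6)[OF k f]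
      by simp
    then show ?thesis
      by (rule B.mono_cancel[OF mono[OF Y] kY B.Comp_in[OF Sf u[OF Y]] B.Comp_in[OF u[OF X] Kf]])
  qed
  then have "natural A B S K (restrict u (Obj A))"
    using u A.Hom_Src_in A.Hom_Tgt_in by (simp add: natural_def)
  then have U: "U \<in> Hom FC S K"
    unfolding Hom_FC_iff U_def using Hom_FC_D(1)[OF s] Hom_FC_D(1)[OF k] by simp
  have "k \<cdot>\<^bsub>FC\<^esub> U = s"
    by (rule nat_trans_eqI[OF Comp_FC_in[OF U k] s])
      (simp add: cmpt_Comp_FC ku, simp add: U_def ku)
  then show ?thesis using U by blast
qed

lemma extend_along_epi_nt:
  assumes q: "q \<in> Hom FC F Q" and s: "s \<in> Hom FC F S"
    and epi: "\<And>X. X \<in> Obj A \<Longrightarrow> epi_arr B (cmpt q X)"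
    and ex: "\<And>X. X \<in> Obj A \<Longrightarrow>
      \<exists>u \<in> Hom B (obj_map Q X) (obj_map S X). u \<cdot>\<^bsub>B\<^esub> cmpt q X = cmpt s X"
  shows "\<exists>u \<in> Hom FC Q S. u \<cdot>\<^bsub>FC\<^esub> q = s"
proof -
  have "\<forall>X \<in> Obj A. \<exists>u. u \<in> Hom B (obj_map Q X) (obj_map S X) \<and> u \<cdot>\<^bsub>B\<^esub> cmpt q X = cmpt s X"
    using ex by blast
  from bchoice[OF this] obtain u where u: "\<And>X. X \<in> Obj A \<Longrightarrow> u X \<in> Hom B (obj_map Q X) (obj_map S X)"
    and uq: "\<And>X. X \<in> Obj A \<Longrightarrow> u X \<cdot>\<^bsub>B\<^esub> cmpt q X = cmpt s X"
    by blast
  define U where "U = \<lparr>nt_src = Q, nt_tgt = S, cmpt = restrict u (Obj A)\<rparr>"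
  have "u Y \<cdot>\<^bsub>B\<^esub> arr_map Q f = arr_map S f \<cdot>\<^bsub>B\<^esub> u X" if f: "f \<in> Hom A X Y" for X Y f
  proof -
    have X: "X \<in> Obj A" and Y: "Y \<in> Obj A" using A.Hom_Src_in[OF f] A.Hom_Tgt_in[OF f] .
    note Sf = additive_functor_arr[OF Hom_FC_D(2)[OF s] f]
    note Qf = additive_functor_arr[OF Hom_FC_D(2)[OF q] f]
    note Ff = additive_functor_arr[OF Hom_FC_D(1)[OF q] f]
    note qX = Hom_FC_D(5)[OF q X] and qY = Hom_FC_D(5)[OF q Y]
    have "(u Y \<cdot>\<^bsub>B\<^esub> arr_map Q f) \<cdot>\<^bsub>B\<^esub> cmpt q X = (arr_map S f \<cdot>\<^bsub>B\<^esub> u X) \<cdot>\<^bsub>B\<^esub> cmpt q X"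
      using B.Comp_assoc[OF qX Qf u[OF Y]] B.Comp_assoc[OF qX u[OF X] Sf]
        B.Comp_assoc[OF Ff qY u[OF Y]] uq[OF X] uq[OF Y] Hom_FC_D(6)[OF s f] Hom_FC_D(6)[OF q f]
      by simp
    then show ?thesis
      by (rule B.epi_cancel[OF epi[OF X] qX B.Comp_in[OF Qf u[OF Y]] B.Comp_in[OF u[OF X] Sf]])
  qed
  then have "natural A B Q S (restrict u (Obj A))"
    using u A.Hom_Src_in A.Hom_Tgt_in by (simp add: natural_def)
  then have U: "U \<in> Hom FC Q S"
    unfolding Hom_FC_iff U_def using Hom_FC_D(2)[OF s] Hom_FC_D(2)[OF q] by simp
  have "U \<cdot>\<^bsub>FC\<^esub> q = s"
    by (rule nat_trans_eqI[OF Comp_FC_in[OF q U] s])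
      (simp add: cmpt_Comp_FC uq, simp add: U_def uq)
  then show ?thesis using U by blast
qed

text \<open>The family \<open>a\<close> need not be functorial itself; it only has to be so after restriction to the
  kernels of the arrows \<open>\<phi> X\<close>. This generality covers \<open>R\<^sup>0F\<close>, where \<open>a f\<close> is the value of \<open>F\<close>
  at a chosen extension of \<open>f\<close> to the injective objects.\<close>

lemma additive_functor_of_kernels:
  assumes \<phi>: "\<And>X. X \<in> Obj A \<Longrightarrow> \<phi> X \<in> Hom B (G X) (H X)"
    and a: "\<And>X Y f. f \<in> Hom A X Y \<Longrightarrow> a f \<in> Hom B (G X) (G Y)"
    and z: "\<And>X Y f. f \<in> Hom A X Y \<Longrightarrow>
      \<phi> Y \<cdot>\<^bsub>B\<^esub> (a f \<cdot>\<^bsub>B\<^esub> ker B (\<phi> X)) = Zero B (Src B (ker B (\<phi> X))) (H Y)"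
    and Ident: "\<And>X. X \<in> Obj A \<Longrightarrow> a (Ident A X) \<cdot>\<^bsub>B\<^esub> ker B (\<phi> X) = ker B (\<phi> X)"
    and Comp: "\<And>X Y Z f g. \<lbrakk>f \<in> Hom A X Y; g \<in> Hom A Y Z\<rbrakk> \<Longrightarrow>
      a (g \<cdot>\<^bsub>A\<^esub> f) \<cdot>\<^bsub>B\<^esub> ker B (\<phi> X) = (a g \<cdot>\<^bsub>B\<^esub> a f) \<cdot>\<^bsub>B\<^esub> ker B (\<phi> X)"
    and Add: "\<And>X Y f g. \<lbrakk>f \<in> Hom A X Y; g \<in> Hom A X Y\<rbrakk> \<Longrightarrow>
      a (f \<uplus>\<^bsub>A\<^esub> g) \<cdot>\<^bsub>B\<^esub> ker B (\<phi> X) = (a f \<uplus>\<^bsub>B\<^esub> a g) \<cdot>\<^bsub>B\<^esub> ker B (\<phi> X)"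
  defines "K \<equiv> \<lparr>obj_map = (\<lambda>X. Src B (ker B (\<phi> X))),
      arr_map = (\<lambda>f. ker_map B (\<phi> (Src A f)) (\<phi> (Tgt A f)) (a f))\<rparr>"
  shows "additive_functor A B K \<and> (\<forall>X Y. \<forall>f \<in> Hom A X Y.
    ker B (\<phi> Y) \<cdot>\<^bsub>B\<^esub> arr_map K f = a f \<cdot>\<^bsub>B\<^esub> ker B (\<phi> X))"
proof -
  have k: "ker B (\<phi> X) \<in> Hom B (obj_map K X) (G X)" "mono_arr B (ker B (\<phi> X))"
    if "X \<in> Obj A" for X
    using B.ker_in[OF \<phi>[OF that]] B.ker_props(2)[OF \<phi>[OF that]] by (simp_all add: K_def)
  have K: "arr_map K f \<in> Hom B (obj_map K X) (obj_map K Y)"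
    and sq: "ker B (\<phi> Y) \<cdot>\<^bsub>B\<^esub> arr_map K f = a f \<cdot>\<^bsub>B\<^esub> ker B (\<phi> X)"
    if f: "f \<in> Hom A X Y" for X Y f
  proof -
    have X: "X \<in> Obj A" and Y: "Y \<in> Obj A" using A.Hom_Src_in[OF f] A.Hom_Tgt_in[OF f] .
    show "arr_map K f \<in> Hom B (obj_map K X) (obj_map K Y)"
      and "ker B (\<phi> Y) \<cdot>\<^bsub>B\<^esub> arr_map K f = a f \<cdot>\<^bsub>B\<^esub> ker B (\<phi> X)"
      using B.ker_map_props[OF \<phi>[OF X] \<phi>[OF Y] a[OF f] z[OF f]] HomD[OF f] by (simp_all add: K_def)
  qed
  have uniq: "u = u'" if "Y \<in> Obj A" "u \<in> Hom B W (obj_map K Y)" "u' \<in> Hom B W (obj_map K Y)"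
      "ker B (\<phi> Y) \<cdot>\<^bsub>B\<^esub> u = ker B (\<phi> Y) \<cdot>\<^bsub>B\<^esub> u'" for Y W u u'
    using B.mono_cancel[OF k(2)[OF that(1)] k(1)[OF that(1)] that(2-4)] .
  have KO: "obj_map K X \<in> Obj B" if "X \<in> Obj A" for X using B.Hom_Src_in[OF k(1)[OF that]] .
  have KI: "arr_map K (Ident A X) = Ident B (obj_map K X)" if X: "X \<in> Obj A" for X
    using sq[OF A.Ident_in[OF X]] Ident[OF X] B.Comp_Ident[OF k(1)[OF X]]
    by (intro uniq[OF X K[OF A.Ident_in[OF X]] B.Ident_in[OF KO[OF X]]]) simp
  have KC: "arr_map K (g \<cdot>\<^bsub>A\<^esub> f) = arr_map K g \<cdot>\<^bsub>B\<^esub> arr_map K f"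
    if f: "f \<in> Hom A X Y" and g: "g \<in> Hom A Y Z" for X Y Z f g
  proof -
    have X: "X \<in> Obj A" and Y: "Y \<in> Obj A" and Z: "Z \<in> Obj A"
      using A.Hom_Src_in[OF f] A.Hom_Tgt_in[OF f] A.Hom_Tgt_in[OF g] .
    have gf: "g \<cdot>\<^bsub>A\<^esub> f \<in> Hom A X Z" using A.Comp_in[OF f g] .
    have "ker B (\<phi> Z) \<cdot>\<^bsub>B\<^esub> (arr_map K g \<cdot>\<^bsub>B\<^esub> arr_map K f)
        = (a g \<cdot>\<^bsub>B\<^esub> a f) \<cdot>\<^bsub>B\<^esub> ker B (\<phi> X)"
      using B.Comp_assoc[OF K[OF f] K[OF g] k(1)[OF Z]] B.Comp_assoc[OF K[OF f] k(1)[OF Y] a[OF g]]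
        B.Comp_assoc[OF k(1)[OF X] a[OF f] a[OF g]] sq[OF f] sq[OF g] by simp
    then show ?thesis
      using sq[OF gf] Comp[OF f g] by (intro uniq[OF Z K[OF gf] B.Comp_in[OF K[OF f] K[OF g]]]) simp
  qed
  have KA: "arr_map K (f \<uplus>\<^bsub>A\<^esub> g) = arr_map K f \<uplus>\<^bsub>B\<^esub> arr_map K g"
    if f: "f \<in> Hom A X Y" and g: "g \<in> Hom A X Y" for X Y f g
  proof -
    have X: "X \<in> Obj A" and Y: "Y \<in> Obj A" using A.Hom_Src_in[OF f] A.Hom_Tgt_in[OF f] .
    have fg: "f \<uplus>\<^bsub>A\<^esub> g \<in> Hom A X Y" using A.Add_in[OF f g] .
    have "ker B (\<phi> Y) \<cdot>\<^bsub>B\<^esub> (arr_map K f \<uplus>\<^bsub>B\<^esub> arr_map K g) = (a f \<uplus>\<^bsub>B\<^esub> a g) \<cdot>\<^bsub>B\<^esub> ker B (\<phi> X)"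
      using B.Comp_Add[OF K[OF f] K[OF g] k(1)[OF Y]] B.Add_Comp[OF k(1)[OF X] a[OF f] a[OF g]]
        sq[OF f] sq[OF g] by simp
    then show ?thesis
      using sq[OF fg] Add[OF f g] by (intro uniq[OF Y K[OF fg] B.Add_in[OF K[OF f] K[OF g]]]) simp
  qed
  have "additive_functor A B K"
    unfolding additive_functor_def is_functor_def using KO K KI KC KA by blast
  then show ?thesis using sq by blast
qed

lemma ker_nt_in:
  assumes t: "t \<in> Hom FC F G"
  shows "ker_nt A B t \<in> Hom FC (ker_functor A B t) F"
proof -
  note F = Hom_FC_D(1)[OF t] and src = Hom_FC_D(3)[OF t] and cmp = Hom_FC_D(5)[OF t]
  note nat = Hom_FC_D(6)[OF t]
  note k = B.ker_in[OF cmp] and ker0 = B.ker_props(1)[OF cmp]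
  have *: "additive_functor A B (ker_functor A B t) \<and> (\<forall>X Y. \<forall>f \<in> Hom A X Y.
    ker B (cmpt t Y) \<cdot>\<^bsub>B\<^esub> arr_map (ker_functor A B t) f = arr_map F f \<cdot>\<^bsub>B\<^esub> ker B (cmpt t X))"
    unfolding ker_functor_def src
  proof (rule additive_functor_of_kernels[where \<phi> = "cmpt t" and a = "arr_map F"
        and G = "obj_map F" and H = "obj_map G"])
    fix X assume X: "X \<in> Obj A"
    show "cmpt t X \<in> Hom B (obj_map F X) (obj_map G X)" using cmp[OF X] .
    show "arr_map F (Ident A X) \<cdot>\<^bsub>B\<^esub> ker B (cmpt t X) = ker B (cmpt t X)"
      using additive_functor_Ident[OF F X] B.Ident_Comp[OF k[OF X]] by simp
  next
    fix X Y f assume f: "f \<in> Hom A X Y"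
    have X: "X \<in> Obj A" and Y: "Y \<in> Obj A" using A.Hom_Src_in[OF f] A.Hom_Tgt_in[OF f] .
    note Ff = additive_functor_arr[OF F f]
    note Gf = additive_functor_arr[OF Hom_FC_D(2)[OF t] f]
    show "arr_map F f \<in> Hom B (obj_map F X) (obj_map F Y)" using Ff .
    show "cmpt t Y \<cdot>\<^bsub>B\<^esub> (arr_map F f \<cdot>\<^bsub>B\<^esub> ker B (cmpt t X))
        = Zero B (Src B (ker B (cmpt t X))) (obj_map G Y)"
      using B.Comp_assoc[OF k[OF X] Ff cmp[OF Y]] nat[OF f]
        B.Zero_Comp_right[OF k[OF X] cmp[OF X] Gf ker0[OF X]] by simp
  qed (simp_all add: additive_functor_Comp[OF F] additive_functor_Add[OF F])
  have "natural A B (ker_functor A B t) F (cmpt (ker_nt A B t))"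
    unfolding natural_def using k * A.Hom_Src_in A.Hom_Tgt_in
    by (simp add: ker_nt_def ker_functor_def)
  then show ?thesis
    unfolding Hom_FC_iff using * F src by (simp add: ker_nt_def)
qed

lemma coker_nt_in:
  assumes t: "t \<in> Hom FC F G"
  shows "coker_nt A B t \<in> Hom FC G (coker_functor A B t)"
proof -
  define Q where "Q = coker_functor A B t"
  note F = Hom_FC_D(1)[OF t] and G = Hom_FC_D(2)[OF t] and cmp = Hom_FC_D(5)[OF t]
  have q: "coker B (cmpt t X) \<in> Hom B (obj_map G X) (obj_map Q X)" "epi_arr B (coker B (cmpt t X))"
      "coker B (cmpt t X) \<cdot>\<^bsub>B\<^esub> cmpt t X = Zero B (obj_map F X) (obj_map Q X)"
    if "X \<in> Obj A" for X
    using B.coker_in[OF cmp[OF that]] B.coker_props(1,2)[OF cmp[OF that]]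
    by (simp_all add: Q_def coker_functor_def)
  have Qarr: "arr_map Q f \<in> Hom B (obj_map Q X) (obj_map Q Y)"
    and sq: "arr_map Q f \<cdot>\<^bsub>B\<^esub> coker B (cmpt t X) = coker B (cmpt t Y) \<cdot>\<^bsub>B\<^esub> arr_map G f"
    if f: "f \<in> Hom A X Y" for X Y f
  proof -
    have X: "X \<in> Obj A" and Y: "Y \<in> Obj A" using A.Hom_Src_in[OF f] A.Hom_Tgt_in[OF f] .
    note Ff = additive_functor_arr[OF F f] and Gf = additive_functor_arr[OF G f]
    have "(coker B (cmpt t Y) \<cdot>\<^bsub>B\<^esub> arr_map G f) \<cdot>\<^bsub>B\<^esub> cmpt t X = Zero B (obj_map F X) (obj_map Q Y)"
      using B.Comp_assoc[OF cmp[OF X] Gf q(1)[OF Y]] Hom_FC_D(6)[OF t f]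
        B.Zero_Comp_left[OF Ff cmp[OF Y] q(1)[OF Y] q(3)[OF Y]] by simp
    then have z: "(coker B (cmpt t Y) \<cdot>\<^bsub>B\<^esub> arr_map G f) \<cdot>\<^bsub>B\<^esub> cmpt t X
        = Zero B (obj_map F X) (Tgt B (coker B (cmpt t Y)))"
      by (simp add: Q_def coker_functor_def)
    show "arr_map Q f \<in> Hom B (obj_map Q X) (obj_map Q Y)"
      and "arr_map Q f \<cdot>\<^bsub>B\<^esub> coker B (cmpt t X) = coker B (cmpt t Y) \<cdot>\<^bsub>B\<^esub> arr_map G f"
      using B.coker_map_props[OF cmp[OF X] cmp[OF Y] Gf z] HomD[OF f] Hom_FC_D(4)[OF t]
      by (simp_all add: Q_def coker_functor_def)
  qed
  have uniq: "u = u'" if "X \<in> Obj A" "u \<in> Hom B (obj_map Q X) W" "u' \<in> Hom B (obj_map Q X) W"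
      "u \<cdot>\<^bsub>B\<^esub> coker B (cmpt t X) = u' \<cdot>\<^bsub>B\<^esub> coker B (cmpt t X)" for X W u u'
    using B.epi_cancel[OF q(2)[OF that(1)] q(1)[OF that(1)] that(2-4)] .
  have QO: "obj_map Q X \<in> Obj B" if "X \<in> Obj A" for X using B.Hom_Tgt_in[OF q(1)[OF that]] .
  have QI: "arr_map Q (Ident A X) = Ident B (obj_map Q X)" if X: "X \<in> Obj A" for X
    using sq[OF A.Ident_in[OF X]] additive_functor_Ident[OF G X] B.Comp_Ident[OF q(1)[OF X]]
      B.Ident_Comp[OF q(1)[OF X]]
    by (intro uniq[OF X Qarr[OF A.Ident_in[OF X]] B.Ident_in[OF QO[OF X]]]) simp
  have QC: "arr_map Q (g \<cdot>\<^bsub>A\<^esub> f) = arr_map Q g \<cdot>\<^bsub>B\<^esub> arr_map Q f"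
    if f: "f \<in> Hom A X Y" and g: "g \<in> Hom A Y Z" for X Y Z f g
  proof -
    have X: "X \<in> Obj A" and Y: "Y \<in> Obj A" and Z: "Z \<in> Obj A"
      using A.Hom_Src_in[OF f] A.Hom_Tgt_in[OF f] A.Hom_Tgt_in[OF g] .
    have gf: "g \<cdot>\<^bsub>A\<^esub> f \<in> Hom A X Z" using A.Comp_in[OF f g] .
    note Gf = additive_functor_arr[OF G f] and Gg = additive_functor_arr[OF G g]
    have "(arr_map Q g \<cdot>\<^bsub>B\<^esub> arr_map Q f) \<cdot>\<^bsub>B\<^esub> coker B (cmpt t X)
        = coker B (cmpt t Z) \<cdot>\<^bsub>B\<^esub> (arr_map G g \<cdot>\<^bsub>B\<^esub> arr_map G f)"
      using B.Comp_assoc[OF q(1)[OF X] Qarr[OF f] Qarr[OF g]]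
        B.Comp_assoc[OF Gf q(1)[OF Y] Qarr[OF g]] B.Comp_assoc[OF Gf Gg q(1)[OF Z]]
        sq[OF f] sq[OF g] by simp
    then show ?thesis
      using sq[OF gf] additive_functor_Comp[OF G f g]
      by (intro uniq[OF X Qarr[OF gf] B.Comp_in[OF Qarr[OF f] Qarr[OF g]]]) simp
  qed
  have QA: "arr_map Q (f \<uplus>\<^bsub>A\<^esub> g) = arr_map Q f \<uplus>\<^bsub>B\<^esub> arr_map Q g"
    if f: "f \<in> Hom A X Y" and g: "g \<in> Hom A X Y" for X Y f g
  proof -
    have X: "X \<in> Obj A" and Y: "Y \<in> Obj A" using A.Hom_Src_in[OF f] A.Hom_Tgt_in[OF f] .
    have fg: "f \<uplus>\<^bsub>A\<^esub> g \<in> Hom A X Y" using A.Add_in[OF f g] .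
    note Gf = additive_functor_arr[OF G f] and Gg = additive_functor_arr[OF G g]
    have "(arr_map Q f \<uplus>\<^bsub>B\<^esub> arr_map Q g) \<cdot>\<^bsub>B\<^esub> coker B (cmpt t X)
        = coker B (cmpt t Y) \<cdot>\<^bsub>B\<^esub> (arr_map G f \<uplus>\<^bsub>B\<^esub> arr_map G g)"
      using B.Add_Comp[OF q(1)[OF X] Qarr[OF f] Qarr[OF g]] B.Comp_Add[OF Gf Gg q(1)[OF Y]]
        sq[OF f] sq[OF g] by simp
    then show ?thesis
      using sq[OF fg] additive_functor_Add[OF G f g]
      by (intro uniq[OF X Qarr[OF fg] B.Add_in[OF Qarr[OF f] Qarr[OF g]]]) simp
  qed
  have addQ: "additive_functor A B Q"
    unfolding additive_functor_def is_functor_def using QO Qarr QI QC QA by blast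
  have "natural A B G Q (cmpt (coker_nt A B t))"
    unfolding natural_def using q(1) sq A.Hom_Src_in A.Hom_Tgt_in by (simp add: coker_nt_def)
  then show ?thesis
    unfolding Hom_FC_iff using addQ G Hom_FC_D(4)[OF t] by (simp add: coker_nt_def Q_def)
qed

end


section \<open>The injective stabilization\<close>

locale injective_copresentation = abelian_pair A B
  for A :: "('a, 'f, 'y) preadditive_scheme" and B :: "('b, 'g, 'z) preadditive_scheme" +
  fixes i d :: "'a \<Rightarrow> 'f"
  assumes copresentations: "injective_copresentations A i d"
begin

lemma copresentation:
  assumes "X \<in> Obj A"
  shows "i X \<in> Hom A X (Tgt A (i X))" and "d X \<in> Hom A (Tgt A (i X)) (Tgt A (d X))"
    and "injective_obj A (Tgt A (i X))" and "injective_obj A (Tgt A (d X))"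
    and "mono_arr A (i X)" and "exact A (i X) (d X)"
proof -
  have c: "i X \<in> Arr A" "Src A (i X) = X" "d X \<in> Arr A"
    "injective_obj A (Tgt A (i X))" "injective_obj A (Tgt A (d X))"
    "exact A (Zero A (zero_obj A) X) (i X)" "exact A (i X) (d X)"
    using copresentations assms by (simp_all add: injective_copresentations_def)
  show i: "i X \<in> Hom A X (Tgt A (i X))" using c by (simp add: Hom_def)
  have "Src A (d X) = Tgt A (i X)"
    using c(7) by (auto simp: exact_def is_cokernel_def is_kernel_def)
  then show "d X \<in> Hom A (Tgt A (i X)) (Tgt A (d X))" using c(3) by (simp add: Hom_def)
  show "mono_arr A (i X)" using A.mono_if_exact_Zero[OF c(6) i A.zero_obj_in] .
qed (use copresentations assms in \<open>simp_all add: injective_copresentations_def\<close>)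

text \<open>Both steps of the extension exist because the targets are injective: first over the
  monomorphism \<open>i X\<close>, then over \<open>d X\<close> by exactness.\<close>

lemma copresentation_lift_props:
  assumes f: "f \<in> Hom A X Y"
  shows "copresentation_lift A i d f \<in> Hom A (Tgt A (i X)) (Tgt A (i Y))"
    and "copresentation_lift A i d f \<cdot>\<^bsub>A\<^esub> i X = i Y \<cdot>\<^bsub>A\<^esub> f"
    and "\<exists>b \<in> Hom A (Tgt A (d X)) (Tgt A (d Y)).
      b \<cdot>\<^bsub>A\<^esub> d X = d Y \<cdot>\<^bsub>A\<^esub> copresentation_lift A i d f"
proof -
  have X: "X \<in> Obj A" and Y: "Y \<in> Obj A" using A.Hom_Src_in[OF f] A.Hom_Tgt_in[OF f] .
  note cX = copresentation[OF X] and cY = copresentation[OF Y]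
  obtain a where a: "a \<in> Hom A (Tgt A (i X)) (Tgt A (i Y))" "a \<cdot>\<^bsub>A\<^esub> i X = i Y \<cdot>\<^bsub>A\<^esub> f"
    using A.injective_extend[OF cY(3) cX(5,1) A.Comp_in[OF f cY(1)]] by blast
  have "(d Y \<cdot>\<^bsub>A\<^esub> a) \<cdot>\<^bsub>A\<^esub> i X = d Y \<cdot>\<^bsub>A\<^esub> (i Y \<cdot>\<^bsub>A\<^esub> f)"
    using A.Comp_assoc[OF cX(1) a(1) cY(2)] a(2) by simp
  also have "\<dots> = Zero A X (Tgt A (d Y))"
    using A.Zero_Comp_left[OF f cY(1,2) A.exact_Comp_Zero[OF cY(6,1,2)]] .
  finally have "\<exists>b \<in> Hom A (Tgt A (d X)) (Tgt A (d Y)). b \<cdot>\<^bsub>A\<^esub> d X = d Y \<cdot>\<^bsub>A\<^esub> a"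
    using A.injective_extend_exact[OF cX(6,1,2) cY(4) A.Comp_in[OF a(1) cY(2)]] by blast
  then have "\<exists>a. a \<in> Hom A (Tgt A (i X)) (Tgt A (i Y)) \<and> a \<cdot>\<^bsub>A\<^esub> i X = i Y \<cdot>\<^bsub>A\<^esub> f \<and>
      (\<exists>b \<in> Hom A (Tgt A (d X)) (Tgt A (d Y)). b \<cdot>\<^bsub>A\<^esub> d X = d Y \<cdot>\<^bsub>A\<^esub> a)"
    using a by blast
  from someI_ex[OF this] show "copresentation_lift A i d f \<in> Hom A (Tgt A (i X)) (Tgt A (i Y))"
    and "copresentation_lift A i d f \<cdot>\<^bsub>A\<^esub> i X = i Y \<cdot>\<^bsub>A\<^esub> f"
    and "\<exists>b \<in> Hom A (Tgt A (d X)) (Tgt A (d Y)).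
      b \<cdot>\<^bsub>A\<^esub> d X = d Y \<cdot>\<^bsub>A\<^esub> copresentation_lift A i d f"
    unfolding copresentation_lift_def Let_def HomD(2,3)[OF f] by blast+
qed

text \<open>Two extensions of the same arrow differ by a map that kills \<open>i X\<close>, and such a map factors
  through \<open>d X\<close>.\<close>

lemma extensions_agree_on_kernel:
  assumes F: "additive_functor A B F" and X: "X \<in> Obj A" and I: "injective_obj A I"
    and a: "a \<in> Hom A (Tgt A (i X)) I" and a': "a' \<in> Hom A (Tgt A (i X)) I"
    and eq: "a \<cdot>\<^bsub>A\<^esub> i X = a' \<cdot>\<^bsub>A\<^esub> i X"
  shows "arr_map F a \<cdot>\<^bsub>B\<^esub> ker B (arr_map F (d X)) = arr_map F a' \<cdot>\<^bsub>B\<^esub> ker B (arr_map F (d X))"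
proof -
  note cX = copresentation[OF X]
  let ?k = "ker B (arr_map F (d X))"
  note Fd = additive_functor_arr[OF F cX(2)]
  note k = B.ker_in[OF Fd] and Fa' = additive_functor_arr[OF F a']
  obtain e where e: "e \<in> Hom A (Tgt A (i X)) I" "a = e \<uplus>\<^bsub>A\<^esub> a'" using A.difference_ex[OF a a'] by blast
  have "e \<cdot>\<^bsub>A\<^esub> i X \<uplus>\<^bsub>A\<^esub> a' \<cdot>\<^bsub>A\<^esub> i X = a' \<cdot>\<^bsub>A\<^esub> i X"
    using A.Add_Comp[OF cX(1) e(1) a'] e(2) eq by simp
  then have "e \<cdot>\<^bsub>A\<^esub> i X = Zero A X I"
    using A.Add_eq_right_iff[OF A.Comp_in[OF cX(1) e(1)] A.Comp_in[OF cX(1) a']] by blast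
  then obtain h where h: "h \<in> Hom A (Tgt A (d X)) I" "h \<cdot>\<^bsub>A\<^esub> d X = e"
    using A.injective_extend_exact[OF cX(6,1,2) I e(1)] by blast
  note Fh = additive_functor_arr[OF F h(1)] and Fe = additive_functor_arr[OF F e(1)]
  have "arr_map F e \<cdot>\<^bsub>B\<^esub> ?k = Zero B (Src B ?k) (obj_map F I)"
    using additive_functor_Comp[OF F cX(2) h(1)] h(2)
      B.Zero_Comp_right[OF k Fd Fh B.ker_props(1)[OF Fd]] by simp
  moreover have "arr_map F a \<cdot>\<^bsub>B\<^esub> ?k = arr_map F e \<cdot>\<^bsub>B\<^esub> ?k \<uplus>\<^bsub>B\<^esub> arr_map F a' \<cdot>\<^bsub>B\<^esub> ?k"
    using additive_functor_Add[OF F e(1) a'] e(2) B.Add_Comp[OF k Fe Fa'] by simp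
  ultimately show ?thesis using B.Zero_Add[OF B.Comp_in[OF k Fa']] by simp
qed

lemma R0_additive_functor:
  assumes F: "additive_functor A B F"
  shows "additive_functor A B (R0 A B i d F)"
    and "\<And>X Y f. f \<in> Hom A X Y \<Longrightarrow>
      ker B (arr_map F (d Y)) \<cdot>\<^bsub>B\<^esub> arr_map (R0 A B i d F) f
        = arr_map F (copresentation_lift A i d f) \<cdot>\<^bsub>B\<^esub> ker B (arr_map F (d X))"
proof -
  let ?l = "copresentation_lift A i d" and ?I = "\<lambda>X. Tgt A (i X)"
  note lift = copresentation_lift_props(1) and sq = copresentation_lift_props(2)
  note Fd = additive_functor_arr[OF F copresentation(2)]
  note k = B.ker_in[OF Fd]
  have "additive_functor A B (R0 A B i d F) \<and> (\<forall>X Y. \<forall>f \<in> Hom A X Y.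
      ker B (arr_map F (d Y)) \<cdot>\<^bsub>B\<^esub> arr_map (R0 A B i d F) f
        = arr_map F (?l f) \<cdot>\<^bsub>B\<^esub> ker B (arr_map F (d X)))"
    unfolding R0_def
  proof (rule additive_functor_of_kernels[where \<phi> = "\<lambda>X. arr_map F (d X)"
        and a = "\<lambda>f. arr_map F (?l f)" and G = "\<lambda>X. obj_map F (?I X)"
        and H = "\<lambda>X. obj_map F (Tgt A (d X))"])
    fix X assume X: "X \<in> Obj A"
    note cX = copresentation[OF X] and id = A.Ident_in[OF X]
    show "arr_map F (d X) \<in> Hom B (obj_map F (?I X)) (obj_map F (Tgt A (d X)))" using Fd[OF X] .
    have II: "Ident A (?I X) \<in> Hom A (?I X) (?I X)" using A.Ident_in A.Hom_Tgt_in[OF cX(1)] .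
    have "arr_map F (?l (Ident A X)) \<cdot>\<^bsub>B\<^esub> ker B (arr_map F (d X))
        = arr_map F (Ident A (?I X)) \<cdot>\<^bsub>B\<^esub> ker B (arr_map F (d X))"
      by (rule extensions_agree_on_kernel[OF F X cX(3) lift[OF id] II])
        (simp add: sq[OF id] A.Comp_Ident[OF cX(1)] A.Ident_Comp[OF cX(1)])
    then show "arr_map F (?l (Ident A X)) \<cdot>\<^bsub>B\<^esub> ker B (arr_map F (d X)) = ker B (arr_map F (d X))"
      using additive_functor_Ident[OF F A.Hom_Tgt_in[OF cX(1)]] B.Ident_Comp[OF k[OF X]] by simp
  next
    fix X Y f assume f: "f \<in> Hom A X Y"
    have X: "X \<in> Obj A" and Y: "Y \<in> Obj A" using A.Hom_Src_in[OF f] A.Hom_Tgt_in[OF f] .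
    note Fl = additive_functor_arr[OF F lift[OF f]]
    show "arr_map F (?l f) \<in> Hom B (obj_map F (?I X)) (obj_map F (?I Y))" using Fl .
    obtain b where b: "b \<in> Hom A (Tgt A (d X)) (Tgt A (d Y))" "b \<cdot>\<^bsub>A\<^esub> d X = d Y \<cdot>\<^bsub>A\<^esub> ?l f"
      using copresentation_lift_props(3)[OF f] by blast
    have "arr_map F (d Y) \<cdot>\<^bsub>B\<^esub> arr_map F (?l f) = arr_map F b \<cdot>\<^bsub>B\<^esub> arr_map F (d X)"
      using additive_functor_Comp[OF F copresentation(2)[OF X] b(1)] b(2)
        additive_functor_Comp[OF F lift[OF f] copresentation(2)[OF Y]] by simp
    then show "arr_map F (d Y) \<cdot>\<^bsub>B\<^esub> (arr_map F (?l f) \<cdot>\<^bsub>B\<^esub> ker B (arr_map F (d X)))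
        = Zero B (Src B (ker B (arr_map F (d X)))) (obj_map F (Tgt A (d Y)))"
      using B.Comp_assoc[OF k[OF X] Fl Fd[OF Y]]
        B.Zero_Comp_right[OF k[OF X] Fd[OF X] additive_functor_arr[OF F b(1)]
          B.ker_props(1)[OF Fd[OF X]]] by simp
  next
    fix X Y Z f g assume f: "f \<in> Hom A X Y" and g: "g \<in> Hom A Y Z"
    have X: "X \<in> Obj A" and Y: "Y \<in> Obj A" and Z: "Z \<in> Obj A"
      using A.Hom_Src_in[OF f] A.Hom_Tgt_in[OF f] A.Hom_Tgt_in[OF g] .
    note cX = copresentation[OF X] and cY = copresentation[OF Y] and cZ = copresentation[OF Z]
    have gf: "g \<cdot>\<^bsub>A\<^esub> f \<in> Hom A X Z" using A.Comp_in[OF f g] .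
    have "(?l g \<cdot>\<^bsub>A\<^esub> ?l f) \<cdot>\<^bsub>A\<^esub> i X = i Z \<cdot>\<^bsub>A\<^esub> (g \<cdot>\<^bsub>A\<^esub> f)"
      using A.Comp_assoc[OF cX(1) lift[OF f] lift[OF g]] sq[OF f]
        A.Comp_assoc[OF f cY(1) lift[OF g]] sq[OF g] A.Comp_assoc[OF f g cZ(1)] by simp
    then show "arr_map F (?l (g \<cdot>\<^bsub>A\<^esub> f)) \<cdot>\<^bsub>B\<^esub> ker B (arr_map F (d X))
        = (arr_map F (?l g) \<cdot>\<^bsub>B\<^esub> arr_map F (?l f)) \<cdot>\<^bsub>B\<^esub> ker B (arr_map F (d X))"
      using extensions_agree_on_kernel[OF F X cZ(3) lift[OF gf] A.Comp_in[OF lift[OF f] lift[OF g]]]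
        sq[OF gf] additive_functor_Comp[OF F lift[OF f] lift[OF g]] by simp
  next
    fix X Y f g assume f: "f \<in> Hom A X Y" and g: "g \<in> Hom A X Y"
    have X: "X \<in> Obj A" and Y: "Y \<in> Obj A" using A.Hom_Src_in[OF f] A.Hom_Tgt_in[OF f] .
    note cX = copresentation[OF X] and cY = copresentation[OF Y]
    have fg: "f \<uplus>\<^bsub>A\<^esub> g \<in> Hom A X Y" using A.Add_in[OF f g] .
    have "(?l f \<uplus>\<^bsub>A\<^esub> ?l g) \<cdot>\<^bsub>A\<^esub> i X = i Y \<cdot>\<^bsub>A\<^esub> (f \<uplus>\<^bsub>A\<^esub> g)"
      using A.Add_Comp[OF cX(1) lift[OF f] lift[OF g]] sq[OF f] sq[OF g]
        A.Comp_Add[OF f g cY(1)] by simp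
    then show "arr_map F (?l (f \<uplus>\<^bsub>A\<^esub> g)) \<cdot>\<^bsub>B\<^esub> ker B (arr_map F (d X))
        = (arr_map F (?l f) \<uplus>\<^bsub>B\<^esub> arr_map F (?l g)) \<cdot>\<^bsub>B\<^esub> ker B (arr_map F (d X))"
      using extensions_agree_on_kernel[OF F X cY(3) lift[OF fg] A.Add_in[OF lift[OF f] lift[OF g]]]
        sq[OF fg] additive_functor_Add[OF F lift[OF f] lift[OF g]] by simp
  qed
  then show "additive_functor A B (R0 A B i d F)"
    and "\<And>X Y f. f \<in> Hom A X Y \<Longrightarrow>
      ker B (arr_map F (d Y)) \<cdot>\<^bsub>B\<^esub> arr_map (R0 A B i d F) f
        = arr_map F (?l f) \<cdot>\<^bsub>B\<^esub> ker B (arr_map F (d X))" by blast+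
qed

lemma rho_cmpt:
  assumes F: "additive_functor A B F" and X: "X \<in> Obj A"
  shows "cmpt (rho A B i d F) X \<in> Hom B (obj_map F X) (obj_map (R0 A B i d F) X)"
    and "ker B (arr_map F (d X)) \<cdot>\<^bsub>B\<^esub> cmpt (rho A B i d F) X = arr_map F (i X)"
proof -
  note cX = copresentation[OF X]
  note Fi = additive_functor_arr[OF F cX(1)] and Fd = additive_functor_arr[OF F cX(2)]
  have XO: "Tgt A (d X) \<in> Obj A" using A.Hom_Tgt_in[OF cX(2)] .
  have "arr_map F (d X) \<cdot>\<^bsub>B\<^esub> arr_map F (i X) = Zero B (obj_map F X) (obj_map F (Tgt A (d X)))"
    using additive_functor_Comp[OF F cX(1,2)] A.exact_Comp_Zero[OF cX(6,1,2)]
      additive_functor_Zero[OF F X XO] by simp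
  from B.ker_props(3)[OF Fd Fi this]
  have "\<exists>!u. u \<in> Hom B (obj_map F X) (Src B (ker B (arr_map F (d X)))) \<and>
      ker B (arr_map F (d X)) \<cdot>\<^bsub>B\<^esub> u = arr_map F (i X)"
    using B.mono_cancel[OF B.ker_props(2)[OF Fd] B.ker_in[OF Fd]] by metis
  from theI'[OF this] X
  show "cmpt (rho A B i d F) X \<in> Hom B (obj_map F X) (obj_map (R0 A B i d F) X)"
    and "ker B (arr_map F (d X)) \<cdot>\<^bsub>B\<^esub> cmpt (rho A B i d F) X = arr_map F (i X)"
    by (simp_all add: rho_def R0_def)
qed

lemma rho_in:
  assumes F: "additive_functor A B F"
  shows "rho A B i d F \<in> Hom FC F (R0 A B i d F)"
proof -
  let ?r = "cmpt (rho A B i d F)" and ?R = "R0 A B i d F" and ?l = "copresentation_lift A i d"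
  have "?r Y \<cdot>\<^bsub>B\<^esub> arr_map F f = arr_map ?R f \<cdot>\<^bsub>B\<^esub> ?r X" if f: "f \<in> Hom A X Y" for X Y f
  proof -
    have X: "X \<in> Obj A" and Y: "Y \<in> Obj A" using A.Hom_Src_in[OF f] A.Hom_Tgt_in[OF f] .
    note cX = copresentation[OF X] and cY = copresentation[OF Y]
    note FdX = additive_functor_arr[OF F cX(2)] and FdY = additive_functor_arr[OF F cY(2)]
    have kX: "ker B (arr_map F (d X)) \<in> Hom B (obj_map ?R X) (obj_map F (Tgt A (i X)))"
      and kY: "ker B (arr_map F (d Y)) \<in> Hom B (obj_map ?R Y) (obj_map F (Tgt A (i Y)))"
      using B.ker_in[OF FdX] B.ker_in[OF FdY] by (simp_all add: R0_def)
    note rX = rho_cmpt[OF F X] and rY = rho_cmpt[OF F Y]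
    note Ff = additive_functor_arr[OF F f]
    note Rf = additive_functor_arr[OF R0_additive_functor(1)[OF F] f]
    note lf = copresentation_lift_props(1)[OF f]
    note Fl = additive_functor_arr[OF F lf]
    have "ker B (arr_map F (d Y)) \<cdot>\<^bsub>B\<^esub> (?r Y \<cdot>\<^bsub>B\<^esub> arr_map F f) = arr_map F (i Y \<cdot>\<^bsub>A\<^esub> f)"
      using B.Comp_assoc[OF Ff rY(1) kY] rY(2) additive_functor_Comp[OF F f cY(1)] by simp
    also have "\<dots> = arr_map F (?l f) \<cdot>\<^bsub>B\<^esub> arr_map F (i X)"
      using copresentation_lift_props(2)[OF f] additive_functor_Comp[OF F cX(1) lf] by simp
    also have "\<dots> = ker B (arr_map F (d Y)) \<cdot>\<^bsub>B\<^esub> (arr_map ?R f \<cdot>\<^bsub>B\<^esub> ?r X)"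
      using B.Comp_assoc[OF rX(1) kX Fl] rX(2) R0_additive_functor(2)[OF F f]
        B.Comp_assoc[OF rX(1) Rf kY] by simp
    finally show ?thesis
      by (rule B.mono_cancel[OF B.ker_props(2)[OF FdY] kY B.Comp_in[OF Ff rY(1)] B.Comp_in[OF rX(1) Rf]])
  qed
  then have "natural A B F ?R ?r" using rho_cmpt(1)[OF F] by (simp add: natural_def)
  then show ?thesis
    unfolding Hom_FC_iff using F R0_additive_functor(1)[OF F] by (simp add: rho_def)
qed

lemma alpha_in:
  "additive_functor A B F \<Longrightarrow> alpha A B i d F \<in> Hom FC (injective_stabilization A B i d F) F"
  unfolding alpha_def injective_stabilization_def by (rule ker_nt_in[OF rho_in])

lemma alpha_cmpt_is_kernel:
  assumes F: "additive_functor A B F" and X: "X \<in> Obj A"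
  shows "is_kernel B (cmpt (rho A B i d F) X) (cmpt (alpha A B i d F) X)"
  using B.is_kernel_ker[OF rho_cmpt(1)[OF F X]] X by (simp add: alpha_def ker_nt_def)

text \<open>The kernel of \<open>\<rho>\<^sub>F\<close> is also the kernel of \<open>F(i)\<close>, since \<open>F(i)\<close> is \<open>\<rho>\<^sub>F\<close> followed by a
  monomorphism.\<close>

lemma is_kernel_rho_iff:
  assumes F: "additive_functor A B F" and X: "X \<in> Obj A" and k: "k \<in> Hom B K (obj_map F X)"
  shows "is_kernel B (cmpt (rho A B i d F) X) k \<longleftrightarrow> is_kernel B (arr_map F (i X)) k"
proof -
  note Fd = additive_functor_arr[OF F copresentation(2)[OF X]]
  have "ker B (arr_map F (d X)) \<in> Hom B (obj_map (R0 A B i d F) X) (obj_map F (Tgt A (i X)))"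
    using B.ker_in[OF Fd] by (simp add: R0_def)
  from B.is_kernel_mono_postcomposite[OF rho_cmpt(1)[OF F X] this B.ker_props(2)[OF Fd] k]
  show ?thesis using rho_cmpt(2)[OF F X] by simp
qed

text \<open>A natural transformation whose source vanishes on injective objects is killed by \<open>\<rho>\<^sub>F\<close>:
  by naturality along \<open>i X\<close>, its composite with \<open>F(i X)\<close> factors through its component at an
  injective object.\<close>

lemma rho_kills:
  assumes t: "t \<in> Hom FC S F"
    and vanish: "\<And>I. injective_obj A I \<Longrightarrow> cmpt t I = Zero B (obj_map S I) (obj_map F I)"
    and X: "X \<in> Obj A"
  shows "cmpt (rho A B i d F) X \<cdot>\<^bsub>B\<^esub> cmpt t X = Zero B (obj_map S X) (obj_map (R0 A B i d F) X)"
proof -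
  note F = Hom_FC_D(2)[OF t] and S = Hom_FC_D(1)[OF t] and cX = copresentation[OF X]
  let ?k = "ker B (arr_map F (d X))"
  note Fd = additive_functor_arr[OF F cX(2)] and tX = Hom_FC_D(5)[OF t X] and r = rho_cmpt[OF F X]
  note Si = additive_functor_arr[OF S cX(1)]
  have k: "?k \<in> Hom B (obj_map (R0 A B i d F) X) (obj_map F (Tgt A (i X)))"
    using B.ker_in[OF Fd] by (simp add: R0_def)
  have FI: "obj_map F (Tgt A (i X)) \<in> Obj B" using B.Hom_Tgt_in[OF k] .
  have "?k \<cdot>\<^bsub>B\<^esub> (cmpt (rho A B i d F) X \<cdot>\<^bsub>B\<^esub> cmpt t X) = arr_map F (i X) \<cdot>\<^bsub>B\<^esub> cmpt t X"
    using B.Comp_assoc[OF tX r(1) k] r(2) by simp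
  also have "\<dots> = Zero B (obj_map S X) (obj_map F (Tgt A (i X)))"
    using Hom_FC_D(6)[OF t cX(1)] vanish[OF cX(3)] B.Zero_Comp[OF Si FI] by simp
  finally show ?thesis
    using B.mono_cancel_Zero[OF B.ker_props(2)[OF Fd] k B.Comp_in[OF tX r(1)]] by blast
qed

end


section \<open>The counit and the injective stabilization\<close>

context abelian_pair
begin

text \<open>For injective \<open>I\<close> the epimorphism \<open>s I\<close> splits, so \<open>G(s I)\<close> is epi and its cokernel
  \<open>S\<^sup>1G(I)\<close> vanishes.\<close>

lemma right_satellite_vanishes:
  assumes cosyz: "cosyzygy_sequences A v s" and G: "additive_functor A B G"
    and I: "injective_obj A I" and g: "g \<in> Hom B (obj_map (right_satellite_obj A B v s G) I) Z"
  shows "g = Zero B (obj_map (right_satellite_obj A B v s G) I) Z"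
proof -
  have IO: "I \<in> Obj A" using I by (simp add: injective_obj_def)
  have c: "v I \<in> Arr A" "s I \<in> Arr A" "Src A (v I) = I" "injective_obj A (Src A (s I))"
    "short_exact A (v I) (s I)"
    using cosyz IO by (simp_all add: cosyzygy_sequences_def)
  have "Src A (s I) = Tgt A (v I)"
    using c(5) by (auto simp: short_exact_def exact_def is_cokernel_def is_kernel_def)
  then have v: "v I \<in> Hom A I (Src A (s I))" and s: "s I \<in> Hom A (Src A (s I)) (Tgt A (s I))"
    using c by (simp_all add: Hom_def)
  obtain t where t: "t \<in> Hom A (Tgt A (s I)) (Src A (s I))" "s I \<cdot>\<^bsub>A\<^esub> t = Ident A (Tgt A (s I))"
    using A.short_exact_injective_splits[OF c(5) v s I c(4)] by blast
  note Gs = additive_functor_arr[OF G s] and Gt = additive_functor_arr[OF G t(1)]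
  have epi: "epi_arr B (arr_map G (s I))"
    using B.epi_if_section[OF Gs Gt] additive_functor_Comp[OF G t(1) s] t(2)
      additive_functor_Ident[OF G A.Hom_Tgt_in[OF s]] by simp
  let ?q = "coker B (arr_map G (s I))"
  note q = B.coker_in[OF Gs] and qp = B.coker_props[OF Gs]
  have g': "g \<in> Hom B (Tgt B ?q) Z" using g by (simp add: right_satellite_obj_def)
  have "?q = Zero B (obj_map G (Tgt A (s I))) (Tgt B ?q)"
    using B.epi_cancel_Zero[OF epi Gs q qp(1)] .
  then have "g \<cdot>\<^bsub>B\<^esub> ?q = Zero B (obj_map G (Tgt A (s I))) Z"
    using B.Comp_Zero[OF g' B.Hom_Src_in[OF q]] by simp
  then show ?thesis using B.epi_cancel_Zero[OF qp(2) q g'] by (simp add: right_satellite_obj_def)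
qed

end

context injective_copresentation
begin

text \<open>At \<open>I = Tgt (i X)\<close> the map \<open>t\<close> is zero, so \<open>q\<close> is mono there. Hence
  \<open>Q(i X) q\<^sub>X = q\<^sub>I F(i X) = q\<^sub>I k \<gamma>\<^sub>X q\<^sub>X\<close>, where \<open>k\<close> is the inclusion of \<open>R\<^sup>0F(X)\<close>, exhibits
  \<open>Q(i X)\<close> as \<open>\<gamma>\<^sub>X\<close> followed by a monomorphism.\<close>

lemma alpha_coker_is_kernel:
  assumes t: "t \<in> Hom FC S F"
    and vanish: "\<And>I. injective_obj A I \<Longrightarrow> cmpt t I = Zero B (obj_map S I) (obj_map F I)"
    and \<gamma>: "\<gamma> \<in> Hom FC (coker_functor A B t) (R0 A B i d F)"
    and \<gamma>q: "\<gamma> \<cdot>\<^bsub>FC\<^esub> coker_nt A B t = rho A B i d F" and X: "X \<in> Obj A"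
  shows "is_kernel B (cmpt \<gamma> X) (cmpt (alpha A B i d (coker_functor A B t)) X)"
proof -
  let ?Q = "coker_functor A B t" and ?q = "cmpt (coker_nt A B t)" and ?I = "Tgt A (i X)"
  note q = coker_nt_in[OF t]
  note F = Hom_FC_D(2)[OF t] and S = Hom_FC_D(1)[OF t] and Q = Hom_FC_D(2)[OF q]
  note cX = copresentation[OF X]
  have I: "?I \<in> Obj A" using A.Hom_Tgt_in[OF cX(1)] .
  note qX = Hom_FC_D(5)[OF q X] and qI = Hom_FC_D(5)[OF q I] and gX = Hom_FC_D(5)[OF \<gamma> X]
  have epi_q: "epi_arr B (?q X)"
    using B.coker_props(2)[OF Hom_FC_D(5)[OF t X]] X by (simp add: coker_nt_def)
  have "is_cokernel B (Zero B (obj_map S ?I) (obj_map F ?I)) (?q ?I)"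
    using B.is_cokernel_coker[OF Hom_FC_D(5)[OF t I]] vanish[OF cX(3)] I by (simp add: coker_nt_def)
  then have mono_qI: "mono_arr B (?q ?I)"
    using B.cokernel_of_Zero_is_mono additive_functor_obj[OF S I] additive_functor_obj[OF F I] by blast
  let ?k = "ker B (arr_map F (d X))"
  note Fd = additive_functor_arr[OF F cX(2)] and r = rho_cmpt[OF F X]
  have k: "?k \<in> Hom B (obj_map (R0 A B i d F) X) (obj_map F ?I)"
    using B.ker_in[OF Fd] by (simp add: R0_def)
  let ?m = "?q ?I \<cdot>\<^bsub>B\<^esub> ?k"
  have m: "?m \<in> Hom B (obj_map (R0 A B i d F) X) (obj_map ?Q ?I)" using B.Comp_in[OF k qI] .
  have mono_m: "mono_arr B ?m" using B.mono_Comp[OF B.ker_props(2)[OF Fd] mono_qI k qI] .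
  have gq: "cmpt \<gamma> X \<cdot>\<^bsub>B\<^esub> ?q X = cmpt (rho A B i d F) X"
    using \<gamma>q cmpt_Comp_FC[OF X, of \<gamma> "coker_nt A B t"] by simp
  note Qi = additive_functor_arr[OF Q cX(1)]
  have "(?m \<cdot>\<^bsub>B\<^esub> cmpt \<gamma> X) \<cdot>\<^bsub>B\<^esub> ?q X = ?m \<cdot>\<^bsub>B\<^esub> cmpt (rho A B i d F) X"
    using B.Comp_assoc[OF qX gX m] gq by simp
  also have "\<dots> = ?q ?I \<cdot>\<^bsub>B\<^esub> arr_map F (i X)" using B.Comp_assoc[OF r(1) k qI] r(2) by simp
  also have "\<dots> = arr_map ?Q (i X) \<cdot>\<^bsub>B\<^esub> ?q X" using Hom_FC_D(6)[OF q cX(1)] .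
  finally have Qi_eq: "?m \<cdot>\<^bsub>B\<^esub> cmpt \<gamma> X = arr_map ?Q (i X)"
    by (rule B.epi_cancel[OF epi_q qX B.Comp_in[OF gX m] Qi])
  note a = Hom_FC_D(5)[OF alpha_in[OF Q] X]
  have "is_kernel B (arr_map ?Q (i X)) (cmpt (alpha A B i d ?Q) X)"
    using alpha_cmpt_is_kernel[OF Q X] is_kernel_rho_iff[OF Q X a] by blast
  then show ?thesis
    using B.is_kernel_mono_postcomposite[OF gX m mono_m a] Qi_eq by simp
qed

text \<open>Since \<open>\<rho>\<^sub>F t = 0\<close>, the transformation \<open>t\<close> lifts to \<open>\<theta>\<close> and \<open>\<rho>\<^sub>F\<close> descends to \<open>\<gamma>\<close> with
  \<open>\<gamma> q = \<rho>\<^sub>F\<close>. The arrow \<open>\<beta>\<close> is then the restriction of \<open>q\<close> to the kernels of \<open>\<gamma> q\<close> and \<open>\<gamma>\<close>,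
  the second of which is the injective stabilization of \<open>Q\<close>; so \<open>\<beta>\<close> is a cokernel of \<open>\<theta>\<close>, by
  restricting the cokernel \<open>q\<close> of \<open>t\<close>.\<close>

lemma exact_sequences_of_vanishing_nt:
  assumes t: "t \<in> Hom FC S F"
    and vanish: "\<And>I. injective_obj A I \<Longrightarrow> cmpt t I = Zero B (obj_map S I) (obj_map F I)"
  defines "stab \<equiv> injective_stabilization A B i d"
    and "Q \<equiv> coker_functor A B t"
    and "q \<equiv> coker_nt A B t"
  shows "\<exists>\<theta> \<in> Hom FC S (stab F). \<exists>\<gamma> \<in> Hom FC Q (R0 A B i d F). \<exists>\<beta> \<in> Hom FC (stab F) (stab Q).
           alpha A B i d F \<cdot>\<^bsub>FC\<^esub> \<theta> = t \<and>
           \<gamma> \<cdot>\<^bsub>FC\<^esub> q = rho A B i d F \<and>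
           alpha A B i d Q \<cdot>\<^bsub>FC\<^esub> \<beta> = q \<cdot>\<^bsub>FC\<^esub> alpha A B i d F \<and>
           exact_nt A B \<theta> \<beta> \<and>
           exact_nt A B \<beta> (zero_nt A B (stab Q) (zero_functor B)) \<and>
           exact_nt A B (zero_nt A B (zero_functor B) (stab Q)) (alpha A B i d Q) \<and>
           exact_nt A B (alpha A B i d Q) \<gamma>"
proof -
  let ?aF = "alpha A B i d F" and ?aQ = "alpha A B i d Q"
  let ?r = "rho A B i d F" and ?R = "R0 A B i d F"
  have q: "q \<in> Hom FC F Q" unfolding q_def Q_def by (rule coker_nt_in[OF t])
  note F = Hom_FC_D(2)[OF t] and Q = Hom_FC_D(2)[OF q]
  have aF: "?aF \<in> Hom FC (stab F) F" and aQ: "?aQ \<in> Hom FC (stab Q) Q"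
    unfolding stab_def using alpha_in[OF F] alpha_in[OF Q] .
  note r = rho_in[OF F]
  have cok: "is_cokernel B (cmpt t X) (cmpt q X)" if "X \<in> Obj A" for X
    using B.is_cokernel_coker[OF Hom_FC_D(5)[OF t that]] that by (simp add: q_def coker_nt_def)
  note cokD = B.is_cokernelD[OF cok Hom_FC_D(5)[OF t] Hom_FC_D(5)[OF q]]
  note kerF = alpha_cmpt_is_kernel[OF F]
  note kerFD = B.is_kernelD[OF kerF Hom_FC_D(5)[OF r] Hom_FC_D(5)[OF aF]]
  obtain \<theta> where \<theta>: "\<theta> \<in> Hom FC S (stab F)" "?aF \<cdot>\<^bsub>FC\<^esub> \<theta> = t"
    using lift_through_mono_nt[OF aF t kerFD(2)]
      kerFD(3)[OF _ _ _ Hom_FC_D(5)[OF t] rho_kills[OF t vanish]] by blast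
  obtain \<gamma> where \<gamma>: "\<gamma> \<in> Hom FC Q ?R" "\<gamma> \<cdot>\<^bsub>FC\<^esub> q = ?r"
    using extend_along_epi_nt[OF q r cokD(2)]
      cokD(3)[OF _ _ _ Hom_FC_D(5)[OF r] rho_kills[OF t vanish]] by blast
  have kerQ: "is_kernel B (cmpt \<gamma> X) (cmpt ?aQ X)" if "X \<in> Obj A" for X
    using alpha_coker_is_kernel[OF t vanish _ _ that] \<gamma> unfolding Q_def q_def by blast
  note kerQD = B.is_kernelD[OF kerQ Hom_FC_D(5)[OF \<gamma>(1)] Hom_FC_D(5)[OF aQ]]
  have \<gamma>q: "cmpt \<gamma> X \<cdot>\<^bsub>B\<^esub> cmpt q X = cmpt ?r X" if "X \<in> Obj A" for X
    using \<gamma>(2) cmpt_Comp_FC[OF that, of \<gamma> q] by simp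
  have qa: "q \<cdot>\<^bsub>FC\<^esub> ?aF \<in> Hom FC (stab F) Q" using Comp_FC_in[OF aF q] .
  have \<gamma>qa: "cmpt \<gamma> X \<cdot>\<^bsub>B\<^esub> cmpt (q \<cdot>\<^bsub>FC\<^esub> ?aF) X = Zero B (obj_map (stab F) X) (obj_map ?R X)"
    if X: "X \<in> Obj A" for X
    using B.Comp_assoc[OF Hom_FC_D(5)[OF aF X] Hom_FC_D(5)[OF q X] Hom_FC_D(5)[OF \<gamma>(1) X]]
      \<gamma>q[OF X] kerFD(1)[OF X X X] cmpt_Comp_FC[OF X, of q ?aF] by simp
  obtain \<beta> where \<beta>: "\<beta> \<in> Hom FC (stab F) (stab Q)" "?aQ \<cdot>\<^bsub>FC\<^esub> \<beta> = q \<cdot>\<^bsub>FC\<^esub> ?aF"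
    using lift_through_mono_nt[OF aQ qa kerQD(2)]
      kerQD(3)[OF _ _ _ Hom_FC_D(5)[OF qa] \<gamma>qa] by blast
  have ex: "exact B (cmpt \<theta> X) (cmpt \<beta> X)"
      "exact B (cmpt \<beta> X) (Zero B (obj_map (stab Q) X) (zero_obj B))"
      "exact B (Zero B (zero_obj B) (obj_map (stab Q) X)) (cmpt ?aQ X)"
      "exact B (cmpt ?aQ X) (cmpt \<gamma> X)" if X: "X \<in> Obj A" for X
  proof -
    note tX = Hom_FC_D(5)[OF t X] and qX = Hom_FC_D(5)[OF q X] and gX = Hom_FC_D(5)[OF \<gamma>(1) X]
      and aFX = Hom_FC_D(5)[OF aF X] and aQX = Hom_FC_D(5)[OF aQ X]
      and thX = Hom_FC_D(5)[OF \<theta>(1) X] and bX = Hom_FC_D(5)[OF \<beta>(1) X]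
    have "is_kernel B (cmpt \<gamma> X \<cdot>\<^bsub>B\<^esub> cmpt q X) (cmpt ?aF X)" using kerF[OF X] \<gamma>q[OF X] by simp
    moreover have "cmpt ?aF X \<cdot>\<^bsub>B\<^esub> cmpt \<theta> X = cmpt t X"
      using \<theta>(2) cmpt_Comp_FC[OF X, of ?aF \<theta>] by simp
    moreover have "cmpt ?aQ X \<cdot>\<^bsub>B\<^esub> cmpt \<beta> X = cmpt q X \<cdot>\<^bsub>B\<^esub> cmpt ?aF X"
      using \<beta>(2) cmpt_Comp_FC[OF X, of ?aQ \<beta>] cmpt_Comp_FC[OF X, of q ?aF] by simp
    ultimately have cok_\<beta>: "is_cokernel B (cmpt \<theta> X) (cmpt \<beta> X)"
      using B.restricted_cokernel[OF tX cok[OF X] qX gX _ aFX kerQ[OF X] aQX thX _ bX] by blast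
    show "exact B (cmpt \<theta> X) (cmpt \<beta> X)" using B.exact_cokernel[OF thX cok_\<beta>] .
    show "exact B (cmpt \<beta> X) (Zero B (obj_map (stab Q) X) (zero_obj B))"
      using B.exact_epi_Zero[OF B.is_cokernelD(2)[OF cok_\<beta> thX bX] bX] .
    show "exact B (Zero B (zero_obj B) (obj_map (stab Q) X)) (cmpt ?aQ X)"
      using B.exact_Zero_mono[OF kerQD(2)[OF X X X] aQX] .
    show "exact B (cmpt ?aQ X) (cmpt \<gamma> X)" using B.exact_kernel[OF gX kerQ[OF X]] .
  qed
  have "exact_nt A B \<theta> \<beta>" "exact_nt A B \<beta> (zero_nt A B (stab Q) (zero_functor B))"
    "exact_nt A B (zero_nt A B (zero_functor B) (stab Q)) ?aQ" "exact_nt A B ?aQ \<gamma>"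
    using ex Hom_FC_D(3,4)[OF \<theta>(1)] Hom_FC_D(3,4)[OF \<beta>(1)] Hom_FC_D(3,4)[OF aQ]
      Hom_FC_D(3,4)[OF \<gamma>(1)]
    by (simp_all add: exact_nt_def zero_nt_def zero_functor_def)
  then show ?thesis using \<theta> \<gamma> \<beta> by blast
qed

end


theorem proposition5p5:
  fixes A :: "('a, 'f) preadditive" and B :: "('b, 'g) preadditive"
    and F :: "('a, 'f, 'b, 'g) cfunctor"
    and i d w p v s :: "'a \<Rightarrow> 'f"
    and \<eta> c :: "('a, 'f, 'b, 'g) cfunctor \<Rightarrow> ('a, 'f, 'b, 'g) nat_trans"
  defines "FC \<equiv> functor_category A B"
    and "SS \<equiv> obj_map (right_satellite A B v s) (obj_map (left_satellite A B w p) F)"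
    and "stab \<equiv> injective_stabilization A B i d"
    and "Q \<equiv> coker_functor A B (c F)"
    and "q \<equiv> coker_nt A B (c F)"
  assumes "abelian_category A" and "abelian_category B"
    and "enough_injectives A" and "enough_projectives A"
    and "injective_copresentations A i d"
    and "syzygy_sequences A w p"
    and "cosyzygy_sequences A v s"
    and "adjunction FC FC (right_satellite A B v s) (left_satellite A B w p) \<eta> c"
    and "additive_functor A B F"
  shows "\<exists>\<theta> \<in> Hom FC SS (stab F). \<exists>\<gamma> \<in> Hom FC Q (R0 A B i d F). \<exists>\<beta> \<in> Hom FC (stab F) (stab Q).
           alpha A B i d F \<cdot>\<^bsub>FC\<^esub> \<theta> = c F \<and>
           \<gamma> \<cdot>\<^bsub>FC\<^esub> q = rho A B i d F \<and>
           alpha A B i d Q \<cdot>\<^bsub>FC\<^esub> \<beta> = q \<cdot>\<^bsub>FC\<^esub> alpha A B i d F \<and>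
           exact_nt A B \<theta> \<beta> \<and>
           exact_nt A B \<beta> (zero_nt A B (stab Q) (zero_functor B)) \<and>
           exact_nt A B (zero_nt A B (zero_functor B) (stab Q)) (alpha A B i d Q) \<and>
           exact_nt A B (alpha A B i d Q) \<gamma>"
proof -
  interpret injective_copresentation A B i d
    using assms(6,7,10) by (simp add: injective_copresentation_def abelian_pair_def
        injective_copresentation_axioms_def)
  have F_Obj: "F \<in> Obj FC" using assms(14) by (simp add: FC_def functor_category_def)
  have R: "is_functor FC FC (right_satellite A B v s)" "is_functor FC FC (left_satellite A B w p)"
    and c: "natural FC FC (comp_functor (right_satellite A B v s) (left_satellite A B w p))
      id_functor c"
    using assms(13) by (simp_all add: adjunction_def)
  have "obj_map (left_satellite A B w p) F \<in> Obj FC" using R(2) F_Obj by (simp add: is_functor_def)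
  then have G: "additive_functor A B (obj_map (left_satellite A B w p) F)"
    by (simp add: FC_def functor_category_def)
  have cF: "c F \<in> Hom FC SS F"
    using c F_Obj by (simp add: natural_def comp_functor_def id_functor_def SS_def)
  have vanish: "cmpt (c F) I = Zero B (obj_map SS I) (obj_map F I)" if I: "injective_obj A I" for I
  proof -
    have IO: "I \<in> Obj A" using I by (simp add: injective_obj_def)
    have "cmpt (c F) I \<in> Hom B (obj_map SS I) (obj_map F I)"
      using Hom_FC_D(5)[OF cF[unfolded FC_def] IO] .
    then show ?thesis
      using right_satellite_vanishes[OF assms(12) G I] by (simp add: SS_def right_satellite_def)
  qed
  show ?thesis
    unfolding FC_def stab_def Q_def q_def
    by (rule exact_sequences_of_vanishing_nt[OF cF[unfolded FC_def] vanish])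
qed

end
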